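(* Let $M = M(S; F(I), G(\Lambda); P)$ be a finitely generated Rees matrix semigroup (without zero) over a semigroupoid $S$. If $S$ is prefix-automatic, and the set of non-identity elements of $S$ is weakly right-ideal-generated by a row cross-section of $P$, then $M$ is prefix-automatic.
   Context: Semigroupoids. A (directed) graph $X$ has a set $X^0$ of vertices, a set $X^1$ of edges, and source and target maps $\alpha,\omega: X^1\to X^0$. A semigroupoid $S$ is a small graph (vertices are called objects, edges are called arrows) with a partial multiplication on arrows such that $ef$ is defined if and only if $\omega(e)=\alpha(f)$, in which case $\alpha(ef)=\alpha(e)$ and $\omega(ef)=\omega(f)$, and $e(fg)=(ef)g$ whenever $ef$ and $fg$ are defined. (Thus a semigroupoid is a small category without the requirement of identities.) We write $s\in S$ for $s\in S^1$. $S$ is isolation-free if every object is the source or target of some arrow. A semigroup is regarded as a semigroupoid with one object. An identity element of $S$ is an arrow $e$ with $\alpha(e)=\omega(e)$ such that $es=s$ and $te=t$ whenever these products are defined. Paths and regularity. For a graph $X$, $X^+$ is the free semigroupoid on $X$: its objects are $X^0$, its arrows are the non-empty paths $e_1\cdots e_n$ with $\omega(e_i)=\alpha(e_{i+1})$. All graphs over which regularity is considered are finite. A language $L\subseteq X^+$ is regular if it is regular in the usual sense as a set of words over the alphabet $X^1$ (equivalently, it is accepted by a finite automaton labelled by the graph $X$). Let $X^{\$}$ be $X$ with one extra loop $\$_s$ at each vertex $s$. For $(a,b)\in X^+\times X^+$, let $\delta_X(a,b)\in (X^{\$}\times X^{\$})^+$ be the path obtained by padding the shorter of $a,b$ on the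 right with copies of $\$_t$, where $t$ is the target of that shorter path, to the length of the longer one, and reading the two paths as a single path of pairs of edges. A relation $R\subseteq X^+\times X^+$ is synchronously regular if $\delta_X(R)$ is a regular language (over the edges of $X^{\$}\times X^{\$}$). Automaticity. A choice of representatives for a semigroupoid $S$ is a triple $(X,K,\rho)$ where $X$ is a graph with $X^0=S^0$, $\rho:X^+\to S$ is a surjective semigroupoid morphism that is the identity on objects, and $K\subseteq X^+$ satisfies $\rho(K)=S^1$. It is finitely generated if $X$ has finitely many edges. An automatic structure for $S$ is a finitely generated choice of representatives $(X,K,\rho)$ such that the relation $K_a=\{(u,v)\in K\times K : \omega(u)=\alpha(a),\ \rho(ua)=\rho(v)\}$ is synchronously regular for each edge $a\in X^1$, and the relation $K_a=\{(u,v)\in K\times K: \omega(u)=a,\ \rho(u)=\rho(v)\}$ is synchronously regular for each vertex $a\in X^0$ (regarded as an empty path). A prefix-automatic structure is an automatic structure $(X,K,\rho)$ such that moreover $K'_= = \{(u,v)\in K\times \mathrm{Pref}(K): \rho(u)=\rho(v)\}$ is synchronously regular, where $\mathrm{Pref}(K)$ is the set of non-empty prefixes of paths in $K$. $S$ is prefix-automatic if it admits a prefix-automatic structure. Rees matrix semigroups without zero. Let $S$ be a non-empty isolation-free semigroupoid, $I,\Lambda$ index sets, $F:I\to\alpha(S^1)$ and $G:\Lambda\to\omega(S^1)$ surjective functions, and $P$ a $\Lambda\times I$ matrix with entries in $S^1$ (no zero entries) such that $\alpha(P_{\lambda i})=G(\lambda)$ and $\omega(P_{\lambda i})=F(i)$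 for all $\lambda\in\Lambda$, $i\in I$. The Rees matrix semigroup (without zero) $M(S;F(I),G(\Lambda);P)$ (the notation $F(I),G(\Lambda)$ is purely symbolic) has elements $\{(i,x,\lambda)\in I\times S\times\Lambda : F(i)=\alpha(x),\ \omega(x)=G(\lambda)\}$, with multiplication $(i,x,\lambda)(j,y,\mu)=(i,xP_{\lambda j}y,\mu)$. Right-ideal-generation. A subset $T\subseteq S^1$ is weakly right-ideal-generated by a row cross-section of $P$ if there is a subset $\Lambda'\subseteq\Lambda$ such that $G$ restricts to a bijection $\Lambda'\to\omega(S^1)$ and every arrow in $T$ can be written in the form $P_{\lambda i}s$ or in the form $P_{\lambda i}$ for some $\lambda\in\Lambda'$, $i\in I$ and, where appropriate, $s\in S^1$. *)

theory Defs
  imports "Graph_Theory.Graph_Theory" "HOL-Library.Sublist"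
begin

text \<open>Graphs are the multigraphs \<open>pre_digraph\<close> of \<open>Graph_Theory\<close>: \<open>tail\<close> is the source map and
  \<open>head\<close> the target map.\<close>

section \<open>Semigroupoids\<close>

record ('v, 'a) pre_semigroupoid = "('v, 'a) pre_digraph" +
  mul :: "'a \<Rightarrow> 'a \<Rightarrow> 'a"

text \<open>The partial product is a total function whose values are constrained only on composable
  pairs. Products are written in path order: \<open>mul S e f\<close> is first \<open>e\<close>, then \<open>f\<close>.\<close>

definition composable :: "('v, 'a) pre_semigroupoid \<Rightarrow> 'a \<Rightarrow> 'a \<Rightarrow> bool" where
  "composable S e f \<longleftrightarrow> e \<in> arcs S \<and> f \<in> arcs S \<and> head S e = tail S f"

locale semigroupoid =
  fixes S :: "('v, 'a) pre_semigroupoid"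
  assumes wf: "wf_digraph (pre_digraph.truncate S)"
    and mul_closed: "composable S e f \<Longrightarrow> mul S e f \<in> arcs S"
    and tail_mul: "composable S e f \<Longrightarrow> tail S (mul S e f) = tail S e"
    and head_mul: "composable S e f \<Longrightarrow> head S (mul S e f) = head S f"
    and mul_assoc: "composable S e f \<Longrightarrow> composable S f g \<Longrightarrow>
      mul S e (mul S f g) = mul S (mul S e f) g"

definition isolation_free :: "('v, 'a) pre_semigroupoid \<Rightarrow> bool" where
  "isolation_free S \<longleftrightarrow> (\<forall>v \<in> verts S. \<exists>s \<in> arcs S. tail S s = v \<or> head S s = v)"

definition is_identity :: "('v, 'a) pre_semigroupoid \<Rightarrow> 'a \<Rightarrow> bool" where
  "is_identity S e \<longleftrightarrow> e \<in> arcs S \<and> tail S e = head S e \<and>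
     (\<forall>s. composable S e s \<longrightarrow> mul S e s = s) \<and> (\<forall>t. composable S t e \<longrightarrow> mul S t e = t)"

definition semigroupoid_hom ::
  "('v, 'a) pre_semigroupoid \<Rightarrow> ('w, 'b) pre_semigroupoid \<Rightarrow> ('v \<Rightarrow> 'w) \<Rightarrow> ('a \<Rightarrow> 'b) \<Rightarrow> bool" where
  "semigroupoid_hom S T f0 f1 \<longleftrightarrow>
     f0 ` verts S \<subseteq> verts T \<and> f1 ` arcs S \<subseteq> arcs T \<and>
     (\<forall>s \<in> arcs S. tail T (f1 s) = f0 (tail S s) \<and> head T (f1 s) = f0 (head S s)) \<and>
     (\<forall>s t. composable S s t \<longrightarrow> f1 (mul S s t) = mul T (f1 s) (f1 t))"

definition free_semigroupoid :: "('v, 'e) pre_digraph \<Rightarrow> ('v, 'e list) pre_semigroupoid" where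
  "free_semigroupoid X =
     \<lparr> verts = verts X,
       arcs = {p. p \<noteq> [] \<and> (\<exists>u v. pre_digraph.awalk X u p v)},
       tail = (\<lambda>p. tail X (hd p)),
       head = (\<lambda>p. head X (last p)),
       mul = (@) \<rparr>"


section \<open>Regular languages and synchronously regular relations\<close>

text \<open>Regularity over a finite alphabet, by acceptance by a finite deterministic automaton.
  Every finite state set can be renamed to a set of natural numbers. Alphabets are required to be
  finite, so that regularity is available only over finite graphs.\<close>

definition regular_language :: "'c set \<Rightarrow> 'c list set \<Rightarrow> bool" where
  "regular_language A L \<longleftrightarrow> finite A \<and>
     (\<exists>(Q :: nat set) q0 \<delta> Acc.
        finite Q \<and> q0 \<in> Q \<and> Acc \<subseteq> Q \<and> (\<forall>q \<in> Q. \<forall>a \<in> A. \<delta> q a \<in> Q) \<and>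
        L = {w \<in> lists A. foldl \<delta> q0 w \<in> Acc})"

text \<open>The padded graph: \<open>Inl e\<close> is the edge \<open>e\<close> and \<open>Inr s\<close> the padding loop at the vertex \<open>s\<close>.\<close>

definition pad_graph :: "('v, 'e) pre_digraph \<Rightarrow> ('v, 'e + 'v) pre_digraph" where
  "pad_graph X =
     \<lparr> verts = verts X, arcs = arcs X <+> verts X,
       tail = case_sum (tail X) (\<lambda>s. s), head = case_sum (head X) (\<lambda>s. s) \<rparr>"

definition prod_graph ::
  "('v, 'e) pre_digraph \<Rightarrow> ('w, 'f) pre_digraph \<Rightarrow> ('v \<times> 'w, 'e \<times> 'f) pre_digraph" where
  "prod_graph X Y =
     \<lparr> verts = verts X \<times> verts Y, arcs = arcs X \<times> arcs Y,
       tail = map_prod (tail X) (tail Y), head = map_prod (head X) (head Y) \<rparr>"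

text \<open>At most one of the two \<open>replicate\<close>s is non-empty, since subtraction is truncated.\<close>

definition pad_pair :: "('v, 'e) pre_digraph \<Rightarrow> 'e list \<Rightarrow> 'e list \<Rightarrow> (('e + 'v) \<times> ('e + 'v)) list"
  where "pad_pair X a b =
     zip (map Inl a @ replicate (length b - length a) (Inr (head X (last a))))
         (map Inl b @ replicate (length a - length b) (Inr (head X (last b))))"

definition sync_regular :: "('v, 'e) pre_digraph \<Rightarrow> ('e list \<times> 'e list) set \<Rightarrow> bool" where
  "sync_regular X R \<longleftrightarrow>
     R \<subseteq> arcs (free_semigroupoid X) \<times> arcs (free_semigroupoid X) \<and>
     regular_language (arcs (prod_graph (pad_graph X) (pad_graph X)))
       ((\<lambda>(a, b). pad_pair X a b) ` R)"


section \<open>Automatic and prefix-automatic structures\<close>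

definition choice_of_representatives ::
  "('v, 'a) pre_semigroupoid \<Rightarrow> ('v, 'e) pre_digraph \<Rightarrow> 'e list set \<Rightarrow> ('e list \<Rightarrow> 'a) \<Rightarrow> bool" where
  "choice_of_representatives S X K \<rho> \<longleftrightarrow>
     wf_digraph X \<and> verts X = verts S \<and>
     semigroupoid_hom (free_semigroupoid X) S id \<rho> \<and>
     \<rho> ` arcs (free_semigroupoid X) = arcs S \<and>
     K \<subseteq> arcs (free_semigroupoid X) \<and> \<rho> ` K = arcs S"

definition fg_choice_of_representatives ::
  "('v, 'a) pre_semigroupoid \<Rightarrow> ('v, 'e) pre_digraph \<Rightarrow> 'e list set \<Rightarrow> ('e list \<Rightarrow> 'a) \<Rightarrow> bool" where
  "fg_choice_of_representatives S X K \<rho> \<longleftrightarrow>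
     choice_of_representatives S X K \<rho> \<and> finite (arcs X)"

definition edge_relation ::
  "('v, 'e) pre_digraph \<Rightarrow> 'e list set \<Rightarrow> ('e list \<Rightarrow> 'a) \<Rightarrow> 'e \<Rightarrow> ('e list \<times> 'e list) set" where
  "edge_relation X K \<rho> a =
     {(u, v) \<in> K \<times> K. head X (last u) = tail X a \<and> \<rho> (u @ [a]) = \<rho> v}"

definition vertex_relation ::
  "('v, 'e) pre_digraph \<Rightarrow> 'e list set \<Rightarrow> ('e list \<Rightarrow> 'a) \<Rightarrow> 'v \<Rightarrow> ('e list \<times> 'e list) set" where
  "vertex_relation X K \<rho> a = {(u, v) \<in> K \<times> K. head X (last u) = a \<and> \<rho> u = \<rho> v}"

definition automatic_structure ::
  "('v, 'a) pre_semigroupoid \<Rightarrow> ('v, 'e) pre_digraph \<Rightarrow> 'e list set \<Rightarrow> ('e list \<Rightarrow> 'a) \<Rightarrow> bool" where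
  "automatic_structure S X K \<rho> \<longleftrightarrow>
     fg_choice_of_representatives S X K \<rho> \<and>
     (\<forall>a \<in> arcs X. sync_regular X (edge_relation X K \<rho> a)) \<and>
     (\<forall>a \<in> verts X. sync_regular X (vertex_relation X K \<rho> a))"

definition Pref :: "'e list set \<Rightarrow> 'e list set" where
  "Pref K = {p. p \<noteq> [] \<and> (\<exists>k \<in> K. prefix p k)}"

definition prefix_automatic_structure ::
  "('v, 'a) pre_semigroupoid \<Rightarrow> ('v, 'e) pre_digraph \<Rightarrow> 'e list set \<Rightarrow> ('e list \<Rightarrow> 'a) \<Rightarrow> bool" where
  "prefix_automatic_structure S X K \<rho> \<longleftrightarrow>
     automatic_structure S X K \<rho> \<and>
     sync_regular X {(u, v) \<in> K \<times> Pref K. \<rho> u = \<rho> v}"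

text \<open>In the next two definitions the graph \<open>X\<close> has the vertices of \<open>S\<close> and only finitely many
  edges, so taking the edges to be natural numbers loses no generality.\<close>

definition prefix_automatic :: "('v, 'a) pre_semigroupoid \<Rightarrow> bool" where
  "prefix_automatic S \<longleftrightarrow>
     (\<exists>(X :: ('v, nat) pre_digraph) K \<rho>. prefix_automatic_structure S X K \<rho>)"

definition finitely_generated :: "('v, 'a) pre_semigroupoid \<Rightarrow> bool" where
  "finitely_generated S \<longleftrightarrow>
     (\<exists>(X :: ('v, nat) pre_digraph) K \<rho>. fg_choice_of_representatives S X K \<rho>)"


section \<open>Rees matrix semigroups without zero\<close>

locale rees_matrix_data = semigroupoid S
  for S :: "('v, 'a) pre_semigroupoid" +
  fixes I :: "'i set" and \<Lambda> :: "'l set"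
    and F :: "'i \<Rightarrow> 'v" and G :: "'l \<Rightarrow> 'v" and P :: "'l \<Rightarrow> 'i \<Rightarrow> 'a"
  assumes nonempty: "arcs S \<noteq> {}"
    and isolation_free: "isolation_free S"
    and F_surj: "F ` I = tail S ` arcs S"
    and G_surj: "G ` \<Lambda> = head S ` arcs S"
    and P_arrow: "l \<in> \<Lambda> \<Longrightarrow> i \<in> I \<Longrightarrow> P l i \<in> arcs S"
    and tail_P: "l \<in> \<Lambda> \<Longrightarrow> i \<in> I \<Longrightarrow> tail S (P l i) = G l"
    and head_P: "l \<in> \<Lambda> \<Longrightarrow> i \<in> I \<Longrightarrow> head S (P l i) = F i"

text \<open>A semigroup is a semigroupoid with one object, here \<open>()\<close>.\<close>

definition rees_matrix_semigroup ::
  "('v, 'a) pre_semigroupoid \<Rightarrow> 'i set \<Rightarrow> 'l set \<Rightarrow> ('i \<Rightarrow> 'v) \<Rightarrow> ('l \<Rightarrow> 'v) \<Rightarrow> ('l \<Rightarrow> 'i \<Rightarrow> 'a) \<Rightarrow>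
    (unit, 'i \<times> 'a \<times> 'l) pre_semigroupoid" where
  "rees_matrix_semigroup S I \<Lambda> F G P =
     \<lparr> verts = {()},
       arcs = {(i, x, l) \<in> I \<times> arcs S \<times> \<Lambda>. F i = tail S x \<and> head S x = G l},
       tail = (\<lambda>_. ()),
       head = (\<lambda>_. ()),
       mul = (\<lambda>(i, x, l) (j, y, m). (i, mul S (mul S x (P l j)) y, m)) \<rparr>"

definition weakly_right_ideal_generated_by_row_cross_section ::
  "('v, 'a) pre_semigroupoid \<Rightarrow> 'i set \<Rightarrow> 'l set \<Rightarrow> ('l \<Rightarrow> 'v) \<Rightarrow> ('l \<Rightarrow> 'i \<Rightarrow> 'a) \<Rightarrow> 'a set \<Rightarrow> bool" where
  "weakly_right_ideal_generated_by_row_cross_section S I \<Lambda> G P T \<longleftrightarrow>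
     (\<exists>\<Lambda>' \<subseteq> \<Lambda>. bij_betw G \<Lambda>' (head S ` arcs S) \<and>
        (\<forall>t \<in> T. \<exists>l \<in> \<Lambda>'. \<exists>i \<in> I.
           t = P l i \<or> (\<exists>s. composable S (P l i) s \<and> t = mul S (P l i) s)))"

end

theory Submission
  imports Defs
begin

text \<open>Replacing \<open>K\<close> by its prefixes and then discarding inefficient words, one gets a prefix-closed
  automatic structure for \<open>S\<close> in which no word has a long factor, other than an initial one, that
  evaluates to an identity. So a block of some fixed length \<open>m\<close> that is not initial evaluates to a
  product \<open>P l i * s\<close> with \<open>l\<close> in the row cross-section, and cutting a representative of \<open>x\<close> into such
  blocks factorises \<open>(i, x, l)\<close> over finitely many generators of the Rees matrix semigroup. These
  factorisations form a prefix-closed language, and corresponding prefixes of two of them spell words of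
  \<open>S\<close> whose lengths differ by a bounded amount, so the multiplier relations of \<open>S\<close> pull back to
  synchronously regular relations.\<close>

section \<open>Regular languages and synchronously regular relations by derivatives\<close>

text \<open>The product of \<open>M\<close> puts an entry of \<open>P\<close> between consecutive
  factors, so the value of every block but the first has to begin with such an entry, which the
  product then restores. The first block is exempt: it is the middle entry of its generator as it
  stands. The hypothesis provides entries only for non-identity arrows, hence the need to ban
  identity factors everywhere except in front. The cross-section makes the row of the entry a
  function of the source of the block; the preceding factor can end in that row, and the value of a
  letter does not depend on its neighbours. Prefix-closedness pays twice: in \<open>S\<close> the
  beginnings left over by cutting are representatives again, and in \<open>M\<close> the relation
  between representatives and their prefixes becomes plain equality of values. Derivatives are
  convenient here because a bounded lag between two words adds only finitely many of them, where an
  automaton would need an explicit buffer.\<close>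

definition lderiv :: "'c list set \<Rightarrow> 'c list \<Rightarrow> 'c list set" where
  "lderiv L w = {x. w @ x \<in> L}"

definition reg :: "'c list set \<Rightarrow> bool" where
  "reg L \<longleftrightarrow> finite (range (lderiv L))"

definition pair_deriv :: "('a list \<times> 'b list) set \<Rightarrow> 'a list \<Rightarrow> 'b list \<Rightarrow> ('a list \<times> 'b list) set" where
  "pair_deriv R p q = {(x, y). (p @ x, q @ y) \<in> R}"

definition fst_deriv :: "('a list \<times> 'b list) set \<Rightarrow> 'a list \<Rightarrow> 'b list \<Rightarrow> 'a list set" where
  "fst_deriv R p q = {x. (p @ x, q) \<in> R}"

definition pair_derivs :: "('a list \<times> 'b list) set \<Rightarrow> ('a list \<times> 'b list) set set" where
  "pair_derivs R = {pair_deriv R p q | p q. length p = length q}"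

definition fst_derivs :: "('a list \<times> 'b list) set \<Rightarrow> 'a list set set" where
  "fst_derivs R = {fst_deriv R p q | p q. length q \<le> length p}"

text \<open>A Myhill-Nerode form of synchronous regularity, without padding letters: the pair derivatives
  are the states reached while both components are being read, the one-sided derivatives those
  reached after the shorter component has ended.\<close>

definition sync :: "('a list \<times> 'b list) set \<Rightarrow> bool" where
  "sync R \<longleftrightarrow> finite (pair_derivs R) \<and> finite (fst_derivs R) \<and> finite (fst_derivs (R\<inverse>))"

lemma lderiv_append: "lderiv L (v @ w) = lderiv (lderiv L v) w"
  by (simp add: lderiv_def)

lemma lderiv_Nil [simp]: "lderiv L [] = L"
  by (simp add: lderiv_def)

lemma reg_finite_lderiv:
  assumes "\<And>w. lderiv L w \<in> F" "finite F"
  shows "reg L"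
  unfolding reg_def using assms by (metis finite_subset image_subsetI)

lemma syncI:
  assumes "finite F" "\<And>p q. length p = length q \<Longrightarrow> pair_deriv R p q \<in> F"
    and "finite F'" "\<And>p q. length q \<le> length p \<Longrightarrow> fst_deriv R p q \<in> F'"
    and "finite F''" "\<And>p q. length q \<le> length p \<Longrightarrow> fst_deriv (R\<inverse>) p q \<in> F''"
  shows "sync R"
proof -
  have "pair_derivs R \<subseteq> F" "fst_derivs R \<subseteq> F'" "fst_derivs (R\<inverse>) \<subseteq> F''"
    unfolding pair_derivs_def fst_derivs_def using assms by auto
  then show ?thesis
    unfolding sync_def using assms by (meson finite_subset)
qed

lemma pair_derivsI: "length p = length q \<Longrightarrow> pair_deriv R p q \<in> pair_derivs R"
  by (auto simp: pair_derivs_def)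

lemma fst_derivsI: "length q \<le> length p \<Longrightarrow> fst_deriv R p q \<in> fst_derivs R"
  by (auto simp: fst_derivs_def)

section \<open>Closure under Boolean operations, composition and projection\<close>

lemma sync_converse:
  assumes "sync R"
  shows "sync (R\<inverse>)"
proof (rule syncI)
  show "finite (converse ` pair_derivs R)"
    using assms by (simp add: sync_def)
  show "pair_deriv (R\<inverse>) p q \<in> converse ` pair_derivs R" if "length p = length q" for p q
  proof
    show "pair_deriv (R\<inverse>) p q = (pair_deriv R q p)\<inverse>"
      by (auto simp: pair_deriv_def)
    show "pair_deriv R q p \<in> pair_derivs R"
      using that by (simp add: pair_derivsI)
  qed
qed (use assms in \<open>auto simp: sync_def fst_derivsI\<close>)

lemma sync_Int:
  assumes "sync R" "sync S"
  shows "sync (R \<inter> S)"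
proof (rule syncI)
  let ?f = "\<lambda>(x, y). x \<inter> y"
  show "finite (?f ` (pair_derivs R \<times> pair_derivs S))"
    "finite ((\<lambda>(x, y). x \<inter> y) ` (fst_derivs R \<times> fst_derivs S))"
    "finite ((\<lambda>(x, y). x \<inter> y) ` (fst_derivs (R\<inverse>) \<times> fst_derivs (S\<inverse>)))"
    using assms by (simp_all add: sync_def)
  show "pair_deriv (R \<inter> S) p q \<in> ?f ` (pair_derivs R \<times> pair_derivs S)"
    if "length p = length q" for p q
  proof
    show "pair_deriv (R \<inter> S) p q = ?f (pair_deriv R p q, pair_deriv S p q)"
      by (auto simp: pair_deriv_def)
  qed (simp add: that pair_derivsI)
  have *: "fst_deriv (U \<inter> V) p q \<in> (\<lambda>(x, y). x \<inter> y) ` (fst_derivs U \<times> fst_derivs V)"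
    if "length q \<le> length p" for p q and U V :: "('c list \<times> 'd list) set"
  proof
    show "fst_deriv (U \<inter> V) p q = (\<lambda>(x, y). x \<inter> y) (fst_deriv U p q, fst_deriv V p q)"
      by (auto simp: fst_deriv_def)
  qed (simp add: that fst_derivsI)
  show "fst_deriv (R \<inter> S) p q \<in> (\<lambda>(x, y). x \<inter> y) ` (fst_derivs R \<times> fst_derivs S)"
    if "length q \<le> length p" for p q
    using *[OF that] .
  show "fst_deriv ((R \<inter> S)\<inverse>) p q \<in> (\<lambda>(x, y). x \<inter> y) ` (fst_derivs (R\<inverse>) \<times> fst_derivs (S\<inverse>))"
    if "length q \<le> length p" for p q
    using *[OF that] by (simp add: converse_Int)
qed

lemma sync_Un:
  assumes "sync R" "sync S"
  shows "sync (R \<union> S)"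
proof (rule syncI)
  let ?f = "\<lambda>(x, y). x \<union> y"
  show "finite (?f ` (pair_derivs R \<times> pair_derivs S))"
    "finite ((\<lambda>(x, y). x \<union> y) ` (fst_derivs R \<times> fst_derivs S))"
    "finite ((\<lambda>(x, y). x \<union> y) ` (fst_derivs (R\<inverse>) \<times> fst_derivs (S\<inverse>)))"
    using assms by (simp_all add: sync_def)
  show "pair_deriv (R \<union> S) p q \<in> ?f ` (pair_derivs R \<times> pair_derivs S)"
    if "length p = length q" for p q
  proof
    show "pair_deriv (R \<union> S) p q = ?f (pair_deriv R p q, pair_deriv S p q)"
      by (auto simp: pair_deriv_def)
  qed (simp add: that pair_derivsI)
  have *: "fst_deriv (U \<union> V) p q \<in> (\<lambda>(x, y). x \<union> y) ` (fst_derivs U \<times> fst_derivs V)"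
    if "length q \<le> length p" for p q and U V :: "('c list \<times> 'd list) set"
  proof
    show "fst_deriv (U \<union> V) p q = (\<lambda>(x, y). x \<union> y) (fst_deriv U p q, fst_deriv V p q)"
      by (auto simp: fst_deriv_def)
  qed (simp add: that fst_derivsI)
  show "fst_deriv (R \<union> S) p q \<in> (\<lambda>(x, y). x \<union> y) ` (fst_derivs R \<times> fst_derivs S)"
    if "length q \<le> length p" for p q
    using *[OF that] .
  show "fst_deriv ((R \<union> S)\<inverse>) p q \<in> (\<lambda>(x, y). x \<union> y) ` (fst_derivs (R\<inverse>) \<times> fst_derivs (S\<inverse>))"
    if "length q \<le> length p" for p q
    using *[OF that] by (simp add: converse_Un)
qed

lemma sync_empty: "sync {}"
  by (rule syncI[where F = "{{}}" and F' = "{{}}" and F'' = "{{}}"])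
    (auto simp: pair_deriv_def fst_deriv_def)

lemma sync_UN:
  assumes "finite J" "\<And>j. j \<in> J \<Longrightarrow> sync (R j)"
  shows "sync (\<Union>j\<in>J. R j)"
  using assms by (induction J) (auto simp: sync_empty sync_Un)

text \<open>A subset construction over the unknown middle word \<open>v\<close>. If \<open>v\<close>
  is longer than \<open>p\<close>, it is cut at \<open>length p\<close> and only the derivatives at
  the first piece matter; otherwise \<open>v\<close> has ended already and a one-sided derivative of
  \<open>R\<close> remains. So every derivative is a union of members of one fixed finite family,
  and such unions are finite in number.\<close>

lemma fst_deriv_relcomp:
  assumes "length q \<le> length p"
  shows "fst_deriv (R O S) p q \<in> Union ` Pow
    ((\<lambda>(a, b). {x. \<exists>v \<in> b. (x, v) \<in> a}) ` (pair_derivs R \<times> fst_derivs S) \<union> fst_derivs R)"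
proof -
  let ?g = "\<lambda>(a, b). {x. \<exists>v \<in> b. (x, v) \<in> a}"
  let ?Z = "{?g (pair_deriv R p v, fst_deriv S v q) | v. length v = length p}
    \<union> {fst_deriv R p v | v. length v \<le> length p \<and> (v, q) \<in> S}"
  have eq: "fst_deriv (R O S) p q = \<Union> ?Z"
  proof (intro equalityI subsetI)
    fix x assume "x \<in> fst_deriv (R O S) p q"
    then obtain v where v: "(p @ x, v) \<in> R" "(v, q) \<in> S"
      by (auto simp: fst_deriv_def)
    show "x \<in> \<Union> ?Z"
    proof (cases "length v \<le> length p")
      case True
      then show ?thesis using v by (auto simp: fst_deriv_def)
    next
      case False
      have "x \<in> ?g (pair_deriv R p (take (length p) v), fst_deriv S (take (length p) v) q)"
        using v unfolding pair_deriv_def fst_deriv_def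
        by (auto intro!: exI[where x = "drop (length p) v"])
      moreover have "length (take (length p) v) = length p" using False by simp
      ultimately show ?thesis by blast
    qed
  next
    fix x assume "x \<in> \<Union> ?Z"
    then show "x \<in> fst_deriv (R O S) p q"
      by (auto simp: fst_deriv_def pair_deriv_def)
  qed
  have sub: "?Z \<subseteq> ?g ` (pair_derivs R \<times> fst_derivs S) \<union> fst_derivs R"
  proof (intro Un_mono subsetI)
    fix z assume "z \<in> {?g (pair_deriv R p v, fst_deriv S v q) | v. length v = length p}"
    then obtain v where v: "z = ?g (pair_deriv R p v, fst_deriv S v q)" "length v = length p"
      by blast
    then have "(pair_deriv R p v, fst_deriv S v q) \<in> pair_derivs R \<times> fst_derivs S"
      using assms by (simp add: pair_derivsI fst_derivsI)
    then show "z \<in> ?g ` (pair_derivs R \<times> fst_derivs S)"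
      using v by blast
  qed (auto simp: fst_derivsI)
  show ?thesis
    unfolding eq by (intro imageI PowI sub)
qed

lemma sync_relcomp:
  assumes "sync R" "sync S"
  shows "sync (R O S)"
proof (rule syncI)
  let ?F = "(\<lambda>(a, b). a O b) ` (pair_derivs R \<times> pair_derivs S)
    \<union> (\<lambda>(a, b). a \<times> b) ` (fst_derivs R \<times> fst_derivs (S\<inverse>))"
  show "finite (Union ` Pow ?F)"
    using assms by (simp add: sync_def)
  show "pair_deriv (R O S) p q \<in> Union ` Pow ?F" if len: "length p = length q" for p q
  proof -
    \<comment> \<open>A middle word that has ended leaves two independent continuations, hence the
      rectangles.\<close>
    let ?Z = "{pair_deriv R p v O pair_deriv S v q | v. length v = length p}
      \<union> {fst_deriv R p v \<times> fst_deriv (S\<inverse>) q v | v. length v \<le> length p}"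
    have eq: "pair_deriv (R O S) p q = \<Union> ?Z"
    proof (intro equalityI subsetI)
      fix z assume "z \<in> pair_deriv (R O S) p q"
      then obtain x y v where z: "z = (x, y)" and v: "(p @ x, v) \<in> R" "(v, q @ y) \<in> S"
        by (auto simp: pair_deriv_def)
      show "z \<in> \<Union> ?Z"
      proof (cases "length v \<le> length p")
        case True
        have "z \<in> fst_deriv R p v \<times> fst_deriv (S\<inverse>) q v"
          using v z by (auto simp: fst_deriv_def)
        then show ?thesis using True by blast
      next
        case False
        let ?v = "take (length p) v"
        have "(x, drop (length p) v) \<in> pair_deriv R p ?v" "(drop (length p) v, y) \<in> pair_deriv S ?v q"
          using v by (auto simp: pair_deriv_def)
        then have "z \<in> pair_deriv R p ?v O pair_deriv S ?v q"
          using z by blast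
        moreover have "length ?v = length p" using False by simp
        ultimately show ?thesis by blast
      qed
    next
      fix z assume "z \<in> \<Union> ?Z"
      then show "z \<in> pair_deriv (R O S) p q"
        by (auto simp: fst_deriv_def pair_deriv_def)
    qed
    have sub: "?Z \<subseteq> ?F"
    proof (intro Un_mono subsetI)
      fix z assume "z \<in> {pair_deriv R p v O pair_deriv S v q | v. length v = length p}"
      then obtain v where v: "z = pair_deriv R p v O pair_deriv S v q" "length v = length p"
        by blast
      then have "(pair_deriv R p v, pair_deriv S v q) \<in> pair_derivs R \<times> pair_derivs S"
        using len by (simp add: pair_derivsI)
      then show "z \<in> (\<lambda>(a, b). a O b) ` (pair_derivs R \<times> pair_derivs S)"
        using v by (metis (no_types, lifting) case_prod_conv image_eqI)
    next
      fix z assume "z \<in> {fst_deriv R p v \<times> fst_deriv (S\<inverse>) q v | v. length v \<le> length p}"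
      then obtain v where v: "z = fst_deriv R p v \<times> fst_deriv (S\<inverse>) q v" "length v \<le> length p"
        by blast
      then have "(fst_deriv R p v, fst_deriv (S\<inverse>) q v) \<in> fst_derivs R \<times> fst_derivs (S\<inverse>)"
        using len by (simp add: fst_derivsI)
      then show "z \<in> (\<lambda>(a, b). a \<times> b) ` (fst_derivs R \<times> fst_derivs (S\<inverse>))"
        by (rule image_eqI[rotated]) (simp add: v(1))
    qed
    show ?thesis
    unfolding eq by (intro imageI PowI sub)
  qed
  let ?F1 = "(\<lambda>(a, b). {x. \<exists>v \<in> b. (x, v) \<in> a}) ` (pair_derivs R \<times> fst_derivs S) \<union> fst_derivs R"
  show "finite (Union ` Pow ?F1)"
    using assms by (simp add: sync_def)
  show "fst_deriv (R O S) p q \<in> Union ` Pow ?F1" if "length q \<le> length p" for p q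
    by (rule fst_deriv_relcomp[OF that])
  let ?F2 = "(\<lambda>(a, b). {x. \<exists>v \<in> b. (x, v) \<in> a}) ` (pair_derivs (S\<inverse>) \<times> fst_derivs (R\<inverse>)) \<union> fst_derivs (S\<inverse>)"
  show "finite (Union ` Pow ?F2)"
    using assms sync_converse[of S] by (simp add: sync_def)
  show "fst_deriv ((R O S)\<inverse>) p q \<in> Union ` Pow ?F2" if "length q \<le> length p" for p q
    unfolding converse_relcomp by (rule fst_deriv_relcomp[OF that])
qed

text \<open>Projection by the same subset construction, now over the unknown second
  component.\<close>

lemma reg_Domain:
  assumes "sync R"
  shows "reg (Domain R)"
proof (rule reg_finite_lderiv)
  let ?F = "Domain ` pair_derivs R \<union> fst_derivs R"
  show "finite (Union ` Pow ?F)"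
    using assms by (simp add: sync_def)
  fix p
  let ?Z = "{Domain (pair_deriv R p q) | q. length p = length q} \<union> {fst_deriv R p q | q. length q \<le> length p}"
  have eq: "lderiv (Domain R) p = \<Union> ?Z"
  proof (intro equalityI subsetI)
    fix x assume "x \<in> lderiv (Domain R) p"
    then obtain v where v: "(p @ x, v) \<in> R" by (auto simp: lderiv_def)
    show "x \<in> \<Union> ?Z"
    proof (cases "length v \<le> length p")
      case True
      then show ?thesis using v by (auto simp: fst_deriv_def)
    next
      case False
      let ?v = "take (length p) v"
      have "(x, drop (length p) v) \<in> pair_deriv R p ?v"
        using v by (auto simp: pair_deriv_def)
      then have "x \<in> Domain (pair_deriv R p ?v)" by blast
      moreover have "length p = length ?v" using False by simp
      ultimately show ?thesis by blast
    qed
  qed (auto simp: lderiv_def pair_deriv_def fst_deriv_def)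
  have sub: "?Z \<subseteq> ?F"
    by (auto simp: pair_derivsI fst_derivsI)
  show "lderiv (Domain R) p \<in> Union ` Pow ?F"
    unfolding eq by (intro imageI PowI sub)
qed

lemma reg_Int:
  assumes "reg L" "reg M"
  shows "reg (L \<inter> M)"
proof (rule reg_finite_lderiv)
  show "lderiv (L \<inter> M) w \<in> (\<lambda>(x, y). x \<inter> y) ` (range (lderiv L) \<times> range (lderiv M))" for w
    by (auto simp: lderiv_def image_iff)
qed (use assms in \<open>simp add: reg_def\<close>)

lemma reg_Compl:
  assumes "reg L"
  shows "reg (- L)"
proof (rule reg_finite_lderiv)
  show "lderiv (- L) w \<in> uminus ` range (lderiv L)" for w
    by (auto simp: lderiv_def image_iff)
qed (use assms in \<open>simp add: reg_def\<close>)

text \<open>Once a word of \<open>L\<close> has been read, every continuation is accepted; this adds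
  the single derivative \<open>UNIV\<close>.\<close>

lemma reg_has_prefix:
  assumes "reg L"
  shows "reg {u. \<exists>p \<in> L. prefix p u}"
proof (rule reg_finite_lderiv)
  let ?f = "\<lambda>M. {u. \<exists>p \<in> M. prefix p u}"
  show "lderiv (?f L) w \<in> insert UNIV (?f ` range (lderiv L))" for w
  proof (cases "\<exists>p \<in> L. prefix p w")
    case True
    then have "lderiv (?f L) w = UNIV"
      by (auto simp: lderiv_def intro: prefix_prefix)
    then show ?thesis by simp
  next
    case False
    then have "lderiv (?f L) w = ?f (lderiv L w)"
      by (auto simp: lderiv_def prefix_append)
    then show ?thesis by blast
  qed
qed (use assms in \<open>simp add: reg_def\<close>)

lemma sync_Times:
  assumes "reg L" "reg M"
  shows "sync (L \<times> M)"
proof (rule syncI)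
  have "fst_deriv (L \<times> M) p q = (if q \<in> M then lderiv L p else {})"
    for p q and L :: "'c list set" and M :: "'d list set"
    by (auto simp: fst_deriv_def lderiv_def)
  then have *: "fst_deriv (L \<times> M) p q \<in> insert {} (range (lderiv L))"
    for p q and L :: "'c list set" and M :: "'d list set"
    by (metis insert_iff rangeI)
  show "pair_deriv (L \<times> M) p q \<in> (\<lambda>(x, y). x \<times> y) ` (range (lderiv L) \<times> range (lderiv M))" for p q
    by (auto simp: lderiv_def pair_deriv_def image_iff)
  show "fst_deriv (L \<times> M) p q \<in> insert {} (range (lderiv L))" for p q
    by (rule *)
  show "fst_deriv ((L \<times> M)\<inverse>) p q \<in> insert {} (range (lderiv M))" for p q
    using *[of M L p q] by (simp add: converse_Times)
qed (use assms in \<open>simp_all add: reg_def\<close>)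

section \<open>Length comparison, bounded lag and pumping\<close>

lemma sync_longer: "sync {(p, q). length q + N \<le> length p}" (is "sync ?R")
proof (rule syncI)
  show "pair_deriv ?R p q \<in> {?R}" if "length p = length q" for p q
    using that by (auto simp: pair_deriv_def)
  \<comment> \<open>After \<open>q\<close> has ended only the surplus of \<open>p\<close> counts,
    and only up to \<open>N\<close>.\<close>
  show "fst_deriv ?R p q \<in> (\<lambda>k. {x. N \<le> k + length x}) ` {..N}" if "length q \<le> length p" for p q
  proof
    show "fst_deriv ?R p q = {x. N \<le> min N (length p - length q) + length x}"
      using that by (auto simp: fst_deriv_def)
  qed simp
  show "fst_deriv (?R\<inverse>) p q \<in> Pow {[]}" if "length q \<le> length p" for p q
  proof -
    have "x = []" if "length p + length x + N \<le> length q" for x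
    proof -
      have "length x = 0"
        using that \<open>length q \<le> length p\<close> by linarith
      then show ?thesis by simp
    qed
    then show ?thesis by (fastforce simp: fst_deriv_def)
  qed
qed simp_all

lemma finite_lists_le: "finite A \<Longrightarrow> finite {xs. xs \<in> lists A \<and> length xs \<le> n}"
  using finite_lists_length_le[of A n] by (simp add: lists_eq_set conj_commute Collect_conj_eq)

text \<open>The second word may run ahead by \<open>m\<close> letters. Its overhang is one of
  finitely many words over \<open>B\<close>, and reading it off a pair derivative gives the
  one-sided derivative. This is what lets block codings be read at unequal speeds.\<close>

lemma finite_fst_deriv_shift:
  assumes "sync R" "R \<subseteq> lists A \<times> lists B" "finite B"
  shows "finite {fst_deriv R p q | p q. length q \<le> length p + m}"
proof -
  let ?f = "\<lambda>(D, v). {x. (x, v) \<in> D}"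
  let ?F = "insert {} (fst_derivs R \<union> ?f ` (pair_derivs R \<times> {v. v \<in> lists B \<and> length v \<le> m}))"
  have "fst_deriv R p q \<in> ?F" if len: "length q \<le> length p + m" for p q
  proof (cases "length q \<le> length p \<or> q \<notin> lists B")
    case True
    then show ?thesis
      using assms(2) fst_derivsI[of q p R] by (auto simp: fst_deriv_def)
  next
    case False
    let ?q1 = "take (length p) q" and ?q2 = "drop (length p) q"
    have "fst_deriv R p q = ?f (pair_deriv R p ?q1, ?q2)"
      by (auto simp: fst_deriv_def pair_deriv_def)
    moreover have "pair_deriv R p ?q1 \<in> pair_derivs R"
      using False by (intro pair_derivsI) simp
    moreover have "?q2 \<in> lists B" "length ?q2 \<le> m"
      using False len by (auto dest: in_set_dropD)
    ultimately show ?thesis by blast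
  qed
  then have "{fst_deriv R p q | p q. length q \<le> length p + m} \<subseteq> ?F" by blast
  moreover have "finite ?F"
    using assms finite_lists_le[of B m] unfolding sync_def
    by (intro finite.insertI finite_UnI finite_imageI finite_cartesian_product) auto
  ultimately show ?thesis by (rule finite_subset)
qed

lemma finite_pair_deriv_shift:
  assumes "sync R" "R \<subseteq> lists A \<times> lists B" "finite A" "finite B"
  shows "finite {pair_deriv R p q | p q. length q \<le> length p + m \<and> length p \<le> length q + m}"
proof -
  let ?f = "\<lambda>(D, u, v). pair_deriv D u v"
  let ?W = "\<lambda>A. {v. v \<in> lists A \<and> length v \<le> m}"
  let ?F = "insert {} (?f ` (pair_derivs R \<times> ?W A \<times> ?W B))"
  have "pair_deriv R p q \<in> ?F"
    if len: "length q \<le> length p + m" "length p \<le> length q + m" for p q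
  proof (cases "p \<in> lists A \<and> q \<in> lists B")
    case False
    then have "pair_deriv R p q = {}"
      using assms(2) by (auto simp: pair_deriv_def)
    then show ?thesis by simp
  next
    case True
    let ?n = "min (length p) (length q)"
    have "pair_deriv R p q = ?f (pair_deriv R (take ?n p) (take ?n q), drop ?n p, drop ?n q)"
      by (simp add: pair_deriv_def flip: append_assoc)
    moreover have "pair_deriv R (take ?n p) (take ?n q) \<in> pair_derivs R"
      by (intro pair_derivsI) simp
    moreover have "drop ?n p \<in> ?W A" "drop ?n q \<in> ?W B"
      using len True by (auto dest: in_set_dropD)
    ultimately show ?thesis by blast
  qed
  then have "{pair_deriv R p q | p q. length q \<le> length p + m \<and> length p \<le> length q + m} \<subseteq> ?F"
    by blast
  moreover have "finite ?F"
    using assms finite_lists_le[of A m] finite_lists_le[of B m] unfolding sync_def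
    by (intro finite.insertI finite_UnI finite_imageI finite_cartesian_product) auto
  ultimately show ?thesis by (rule finite_subset)
qed

text \<open>Pigeonhole after the end of \<open>v\<close>: with \<open>N\<close> the number of
  possible pairs of a one-sided derivative of \<open>R\<close> and a derivative of \<open>L\<close>,
  the \<open>N + 1\<close> prefixes of \<open>p\<close> of lengths \<open>length v\<close> to
  \<open>length v + N\<close> cannot all reach different pairs. Cutting out the factor between two
  that agree changes neither what \<open>R\<close> accepts nor the derivative of
  \<open>L\<close>.\<close>

lemma sync_pumping:
  assumes "sync R" "reg L"
  obtains N where "\<And>p v. (p, v) \<in> R \<Longrightarrow> length v + N \<le> length p \<Longrightarrow>
    \<exists>p'. length p' < length p \<and> (p', v) \<in> R \<and> lderiv L p' = lderiv L p"
proof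
  let ?F = "fst_derivs R \<times> range (lderiv L)"
  have fin: "finite ?F"
    using assms by (simp add: sync_def reg_def)
  fix p v assume pv: "(p, v) \<in> R" and len: "length v + card ?F \<le> length p"
  let ?t = "\<lambda>j. take (length v + j) p"
  let ?g = "\<lambda>j. (fst_deriv R (?t j) v, lderiv L (?t j))"
  have "?g ` {..card ?F} \<subseteq> ?F"
  proof
    fix z assume "z \<in> ?g ` {..card ?F}"
    then obtain j where j: "j \<le> card ?F" "z = ?g j" by blast
    have "fst_deriv R (?t j) v \<in> fst_derivs R"
      using j(1) len by (intro fst_derivsI) simp
    then show "z \<in> ?F" using j(2) by blast
  qed
  then have "card (?g ` {..card ?F}) < card {..card ?F}"
    using card_mono[OF fin] by (simp add: less_Suc_eq_le)
  then have "\<not> inj_on ?g {..card ?F}" using card_image by fastforce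
  then obtain j k where jk: "j < k" "k \<le> card ?F" "?g j = ?g k"
    unfolding inj_on_def by (metis atMost_iff linorder_neqE_nat)
  let ?d = "drop (length v + k) p"
  have "?t k @ ?d = p" by simp
  then have "?d \<in> fst_deriv R (?t k) v"
    using pv by (simp add: fst_deriv_def)
  then have "?d \<in> fst_deriv R (?t j) v" using jk(3) by simp
  then have "(?t j @ ?d, v) \<in> R" by (simp add: fst_deriv_def)
  moreover have "lderiv L (?t j @ ?d) = lderiv L p"
    using jk(3) \<open>?t k @ ?d = p\<close> lderiv_append by (metis (no_types, lifting) prod.inject)
  moreover have "length (?t j @ ?d) < length p"
    using jk len by simp
  ultimately show "\<exists>p'. length p' < length p \<and> (p', v) \<in> R \<and> lderiv L p' = lderiv L p"
    by blast
qed


section \<open>Finite automata and padding\<close>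

lemma regular_languageD:
  assumes "regular_language A L"
  shows "finite A" "L \<subseteq> lists A" "reg L"
proof -
  obtain Q :: "nat set" and q0 \<delta> Acc where Q: "finite Q" "q0 \<in> Q"
    and step: "\<forall>q \<in> Q. \<forall>a \<in> A. \<delta> q a \<in> Q" and L: "L = {w \<in> lists A. foldl \<delta> q0 w \<in> Acc}"
    using assms unfolding regular_language_def by blast
  show "finite A"
    using assms by (simp add: regular_language_def)
  show "L \<subseteq> lists A"
    using L by blast
  have run: "q \<in> Q \<Longrightarrow> w \<in> lists A \<Longrightarrow> foldl \<delta> q w \<in> Q" for q w
    by (induction w arbitrary: q) (auto simp: step)
  show "reg L"
  proof (rule reg_finite_lderiv)
    let ?f = "\<lambda>q. {x \<in> lists A. foldl \<delta> q x \<in> Acc}"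
    show "finite (insert {} (?f ` Q))"
      using Q by simp
    fix w
    show "lderiv L w \<in> insert {} (?f ` Q)"
    proof (cases "w \<in> lists A")
      case True
      then have "lderiv L w = ?f (foldl \<delta> q0 w)"
        by (auto simp: lderiv_def L)
      then show ?thesis
        using run[OF Q(2) True] by blast
    qed (auto simp: lderiv_def L)
  qed
qed

text \<open>Myhill-Nerode: the derivatives are the states, numbered by an injection \<open>f\<close>
  because \<open>regular_language\<close> asks for states in \<open>nat\<close>.\<close>

lemma regular_languageI:
  assumes "finite A" "L \<subseteq> lists A" "reg L"
  shows "regular_language A L"
proof -
  let ?D = "range (lderiv L)"
  have fin: "finite ?D"
    using assms(3) by (simp add: reg_def)
  obtain f :: "'a list set \<Rightarrow> nat" and n where "f ` ?D = {i. i < n}" and inj: "inj_on f ?D"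
    using finite_imp_inj_to_nat_seg[OF fin] by (elim exE conjE)
  let ?\<delta> = "\<lambda>n a. f (lderiv (the_inv_into ?D f n) [a])"
  have step: "?\<delta> (f (lderiv L w)) a = f (lderiv L (w @ [a]))" for w a
  proof -
    have "the_inv_into ?D f (f (lderiv L w)) = lderiv L w"
      by (rule the_inv_into_f_f[OF inj]) simp
    then show ?thesis
      by (simp only: lderiv_append)
  qed
  have run: "foldl ?\<delta> (f L) w = f (lderiv L w)" for w
    by (induction w rule: rev_induct) (simp_all add: step)
  let ?Acc = "f ` {M \<in> ?D. [] \<in> M}"
  have acc: "f (lderiv L w) \<in> ?Acc \<longleftrightarrow> w \<in> L" for w
  proof -
    have "f (lderiv L w) \<in> ?Acc \<longleftrightarrow> lderiv L w \<in> {M \<in> ?D. [] \<in> M}"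
      by (rule inj_on_image_mem_iff[OF inj]) auto
    then show ?thesis
      by (simp add: lderiv_def)
  qed
  show ?thesis
    unfolding regular_language_def
  proof (rule conjI, fact assms(1), rule exI[of _ "f ` ?D"], rule exI[of _ "f L"],
      rule exI[of _ ?\<delta>], rule exI[of _ ?Acc], intro conjI)
    show "f L \<in> f ` ?D"
      using lderiv_Nil[of L] by (metis rangeI image_eqI)
    show "\<forall>q \<in> f ` ?D. \<forall>a \<in> A. ?\<delta> q a \<in> f ` ?D"
      using step by auto
    show "L = {w \<in> lists A. foldl ?\<delta> (f L) w \<in> ?Acc}"
      unfolding run acc using assms(2) by blast
  qed (use assms fin in auto)
qed

text \<open>Unlike in \<open>pad_pair\<close>, the padding vertices are parameters and do not depend
  on the last letters; therefore padding commutes with \<open>take\<close> and \<open>drop\<close>,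
  also when a component becomes empty.\<close>

definition padded :: "'v \<Rightarrow> 'w \<Rightarrow> 'a list \<Rightarrow> 'b list \<Rightarrow> (('a + 'v) \<times> ('b + 'w)) list" where
  "padded s t x y = zip (map Inl x @ replicate (length y - length x) (Inr s))
     (map Inl y @ replicate (length x - length y) (Inr t))"

lemma pad_pair_eq_padded:
  "pad_pair X a b = padded (head X (last a)) (head X (last b)) a b"
  by (simp add: pad_pair_def padded_def)

lemma take_padded: "take n (padded s t x y) = padded s t (take n x) (take n y)"
proof -
  have "min (n - i) (j - i) = min j n - min i n" for i j :: nat
    by linarith
  then show ?thesis
    by (simp add: padded_def take_zip take_map)
qed

lemma drop_padded: "drop n (padded s t x y) = padded s t (drop n x) (drop n y)"
proof -
  have "j - i - (n - i) = (j - n) - (i - n)" for i j :: nat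
    by linarith
  then show ?thesis
    by (simp add: padded_def drop_zip drop_map)
qed

lemma length_padded: "length (padded s t x y) = max (length x) (length y)"
  by (simp add: padded_def)

lemma padded_append:
  assumes "length p = length q"
  shows "padded s t (p @ x) (q @ y) = padded s t p q @ padded s t x y"
  using assms by (simp add: padded_def)

lemma padded_append_fst:
  assumes "length q \<le> length p"
  shows "padded s t (p @ x) q = padded s t p q @ padded s t x []"
proof -
  have "padded s t (p @ x) q = take (length p) (padded s t (p @ x) q) @ drop (length p) (padded s t (p @ x) q)"
    by simp
  then show ?thesis
    using assms by (simp add: take_padded drop_padded)
qed

lemma padded_append_snd:
  assumes "length p \<le> length q"
  shows "padded s t p (q @ y) = padded s t p q @ padded s t [] y"
proof -
  have "padded s t p (q @ y) = take (length q) (padded s t p (q @ y)) @ drop (length q) (padded s t p (q @ y))"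
    by simp
  then show ?thesis
    using assms by (simp add: take_padded drop_padded)
qed

text \<open>Erasing the padding letters recovers both words, whatever the padding vertices
  were.\<close>

lemma padded_inject:
  assumes "padded s t x y = padded s' t' x' y'"
  shows "x = x' \<and> y = y'"
proof -
  let ?u = "\<lambda>xs. concat (map (case_sum (\<lambda>a. [a]) (\<lambda>_. [])) xs)"
  have u: "?u (map Inl z @ replicate n (Inr r)) = z" for z n r
    by (induction z) (simp_all add: comp_def concat_replicate_trivial)
  have "?u (map fst (padded s t x y)) = x" "?u (map snd (padded s t x y)) = y" for s t x y
    by (simp_all add: padded_def u del: map_append)
  then show ?thesis
    using assms by metis
qed

lemma sync_padded_vimage:
  assumes "reg L"
  shows "sync {(a, b). padded s t a b \<in> L}" (is "sync ?R")
proof (rule syncI)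
  show "pair_deriv ?R p q \<in> (\<lambda>M. {(x, y). padded s t x y \<in> M}) ` range (lderiv L)"
    if "length p = length q" for p q
    using that by (auto simp: pair_deriv_def padded_append lderiv_def image_iff)
  show "fst_deriv ?R p q \<in> (\<lambda>M. {x. padded s t x [] \<in> M}) ` range (lderiv L)"
    if "length q \<le> length p" for p q
    using that by (auto simp: fst_deriv_def padded_append_fst lderiv_def image_iff)
  show "fst_deriv (?R\<inverse>) p q \<in> (\<lambda>M. {x. padded s t [] x \<in> M}) ` range (lderiv L)"
    if "length q \<le> length p" for p q
    using that by (auto simp: fst_deriv_def padded_append_snd lderiv_def image_iff)
qed (use assms in \<open>simp_all add: reg_def\<close>)

text \<open>A word \<open>w\<close> with a non-empty derivative is itself a padded pair
  \<open>(p, q)\<close>. Which of \<open>p\<close> and \<open>q\<close> is shorter than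
  \<open>w\<close> tells which component has ended, and so which kind of derivative of
  \<open>R\<close> describes the continuations.\<close>

lemma reg_padded_image:
  fixes R :: "('a list \<times> 'b list) set"
  assumes "sync R"
  shows "reg ((\<lambda>(a, b). padded s t a b) ` R)"
proof (rule reg_finite_lderiv)
  let ?P = "\<lambda>(a, b). padded s t a b"
  let ?F = "insert {} ((`) ?P ` pair_derivs R \<union> (\<lambda>M. (\<lambda>x. padded s t x ([] :: 'b list)) ` M) ` fst_derivs R
    \<union> (\<lambda>M. (\<lambda>x. padded s t ([] :: 'a list) x) ` M) ` fst_derivs (R\<inverse>))"
  show "finite ?F"
    using assms by (simp add: sync_def)
  fix w
  show "lderiv (?P ` R) w \<in> ?F"
  proof (cases "lderiv (?P ` R) w = {}")
    case False
    let ?n = "length w"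
    obtain a0 b0 z0 where ab: "w @ z0 = padded s t a0 b0"
      using False by (auto simp: lderiv_def)
    define p q where "p = take ?n a0" and "q = take ?n b0"
    have "w = take ?n (w @ z0)" by simp
    also have "\<dots> = padded s t p q"
      unfolding ab take_padded p_def q_def ..
    finally have w: "w = padded s t p q" .
    have "?n \<le> max (length a0) (length b0)"
      using arg_cong[OF ab, of length] by (simp add: length_padded)
    then have len: "length p \<le> ?n" "length q \<le> ?n" "length p = ?n \<or> length q = ?n"
      by (auto simp: p_def q_def)
    have split: "w @ z = padded s t a b \<longleftrightarrow>
        take ?n a = p \<and> take ?n b = q \<and> z = padded s t (drop ?n a) (drop ?n b)" for a b z
    proof -
      have "w @ z = padded s t a b \<longleftrightarrow>
          w = take ?n (padded s t a b) \<and> z = drop ?n (padded s t a b)"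
        by (metis append_eq_conv_conj)
      then show ?thesis
        unfolding take_padded drop_padded using w padded_inject by metis
    qed
    have D: "lderiv (?P ` R) w = {padded s t (drop ?n a) (drop ?n b) | a b.
        (a, b) \<in> R \<and> take ?n a = p \<and> take ?n b = q}" (is "_ = ?D")
    proof -
      have "lderiv (?P ` R) w = {z. \<exists>a b. (a, b) \<in> R \<and> w @ z = padded s t a b}"
        by (auto simp: lderiv_def image_iff split: prod.splits)
      then show ?thesis
        unfolding split by blast
    qed
    consider "length p = ?n" "length q = ?n" | "length p = ?n" "length q < ?n"
      | "length p < ?n" "length q = ?n"
      using len by linarith
    then show ?thesis
    proof cases
      case 1
      have "?D = ?P ` pair_deriv R p q"
      proof (intro equalityI subsetI)
        fix z assume "z \<in> ?P ` pair_deriv R p q"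
        then obtain x y where "z = padded s t x y" "(p @ x, q @ y) \<in> R"
          by (auto simp: pair_deriv_def)
        then show "z \<in> ?D"
          using 1 by (auto intro!: exI[where x = "p @ x"] exI[where x = "q @ y"])
      next
        fix z assume "z \<in> ?D"
        then obtain a b where ab: "z = padded s t (drop ?n a) (drop ?n b)" "(a, b) \<in> R"
          "take ?n a = p" "take ?n b = q"
          by blast
        then have "(p @ drop ?n a, q @ drop ?n b) \<in> R"
          by (metis append_take_drop_id)
        then show "z \<in> ?P ` pair_deriv R p q"
          using ab by (auto simp: pair_deriv_def)
      qed
      moreover have "pair_deriv R p q \<in> pair_derivs R"
        using 1 by (simp add: pair_derivsI)
      ultimately show ?thesis unfolding D by blast
    next
      case 2
      have "?D = (\<lambda>x. padded s t x ([] :: 'b list)) ` fst_deriv R p q"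
      proof (intro equalityI subsetI)
        fix z assume "z \<in> (\<lambda>x. padded s t x ([] :: 'b list)) ` fst_deriv R p q"
        then obtain x where "z = padded s t x ([] :: 'b list)" "(p @ x, q) \<in> R"
          by (auto simp: fst_deriv_def)
        then show "z \<in> ?D"
          using 2 by (auto intro!: exI[where x = "p @ x"] exI[where x = q])
      next
        fix z assume "z \<in> ?D"
        then obtain a b where ab: "z = padded s t (drop ?n a) (drop ?n b)" "(a, b) \<in> R"
          "take ?n a = p" "take ?n b = q"
          by blast
        \<comment> \<open>A truncation to \<open>?n\<close> letters that is shorter than
          \<open>?n\<close> is the whole word.\<close>
        then have "b = q" "drop ?n b = []"
          using 2(2) by auto
        moreover have "(p @ drop ?n a, b) \<in> R"
          using ab by (metis append_take_drop_id)
        ultimately show "z \<in> (\<lambda>x. padded s t x ([] :: 'b list)) ` fst_deriv R p q"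
          using ab(1) by (auto simp: fst_deriv_def)
      qed
      moreover have "fst_deriv R p q \<in> fst_derivs R"
        using 2 by (simp add: fst_derivsI)
      ultimately show ?thesis unfolding D by blast
    next
      case 3
      have "?D = (\<lambda>x. padded s t ([] :: 'a list) x) ` fst_deriv (R\<inverse>) q p"
      proof (intro equalityI subsetI)
        fix z assume "z \<in> (\<lambda>x. padded s t ([] :: 'a list) x) ` fst_deriv (R\<inverse>) q p"
        then obtain x where "z = padded s t ([] :: 'a list) x" "(p, q @ x) \<in> R"
          by (auto simp: fst_deriv_def)
        then show "z \<in> ?D"
          using 3 by (auto intro!: exI[where x = p] exI[where x = "q @ x"])
      next
        fix z assume "z \<in> ?D"
        then obtain a b where ab: "z = padded s t (drop ?n a) (drop ?n b)" "(a, b) \<in> R"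
          "take ?n a = p" "take ?n b = q"
          by blast
        then have "a = p" "drop ?n a = []"
          using 3(1) by auto
        moreover have "(a, q @ drop ?n b) \<in> R"
          using ab by (metis append_take_drop_id)
        ultimately show "z \<in> (\<lambda>x. padded s t ([] :: 'a list) x) ` fst_deriv (R\<inverse>) q p"
          using ab(1) by (auto simp: fst_deriv_def)
      qed
      moreover have "fst_deriv (R\<inverse>) q p \<in> fst_derivs (R\<inverse>)"
        using 3 by (simp add: fst_derivsI)
      ultimately show ?thesis unfolding D by blast
    qed
  qed simp
qed

lemma arcs_free_semigroupoidD:
  assumes "p \<in> arcs (free_semigroupoid X)"
  shows "p \<noteq> []" "p \<in> lists (arcs X)"
  using assms by (auto simp: free_semigroupoid_def pre_digraph.awalk_def)

text \<open>The padding vertices are targets of edges, so finitely many choices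
  \<open>(s, t)\<close> cover \<open>R\<close>. A wrong choice adds nothing, since by
  \<open>padded_inject\<close> a padded pair in the language comes from a pair in
  \<open>R\<close>.\<close>

lemma sync_regular_imp_sync:
  assumes "finite (arcs X)" "sync_regular X R"
  shows "sync R"
proof -
  let ?V = "head X ` arcs X"
  let ?L = "(\<lambda>(a, b). pad_pair X a b) ` R"
  have sub: "R \<subseteq> arcs (free_semigroupoid X) \<times> arcs (free_semigroupoid X)" and L: "reg ?L"
    using assms(2) regular_languageD(3) unfolding sync_regular_def by auto
  have "R = (\<Union>(s, t) \<in> ?V \<times> ?V. {(a, b). padded s t a b \<in> ?L})"
  proof (intro equalityI subsetI)
    fix z assume z: "z \<in> R"
    then obtain a b where ab: "z = (a, b)" "(a, b) \<in> R" by (cases z) auto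
    then have "a \<noteq> []" "set a \<subseteq> arcs X" "b \<noteq> []" "set b \<subseteq> arcs X"
      using sub arcs_free_semigroupoidD[of a X] arcs_free_semigroupoidD[of b X] by auto
    then have "head X (last a) \<in> ?V" "head X (last b) \<in> ?V"
      using last_in_set by blast+
    moreover have "padded (head X (last a)) (head X (last b)) a b \<in> ?L"
      using ab(2) by (force simp: pad_pair_eq_padded)
    ultimately show "z \<in> (\<Union>(s, t) \<in> ?V \<times> ?V. {(a, b). padded s t a b \<in> ?L})"
      using ab(1) by blast
  next
    fix z assume "z \<in> (\<Union>(s, t) \<in> ?V \<times> ?V. {(a, b). padded s t a b \<in> ?L})"
    then obtain s t where "z \<in> {(a, b). padded s t a b \<in> ?L}" by blast
    then show "z \<in> R"
      by (auto simp: pad_pair_eq_padded dest: padded_inject)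
  qed
  moreover have "sync \<dots>"
    using assms(1) sync_padded_vimage[OF L] by (intro sync_UN) auto
  ultimately show ?thesis by simp
qed

lemma reg_head_last: "reg {a. a \<noteq> [] \<and> h (last a) = s}" (is "reg ?L")
proof (rule reg_finite_lderiv)
  show "lderiv ?L w \<in> {?L, insert [] ?L}" for w
    by (cases "w = [] \<or> h (last w) \<noteq> s") (auto simp: lderiv_def last_append)
qed simp

text \<open>Sorting the pairs by the targets of their two words makes the padding vertices constant
  on each of finitely many pieces.\<close>

lemma sync_imp_sync_regular:
  assumes "wf_digraph X" "finite (arcs X)" "finite (verts X)" "sync R"
    and sub: "R \<subseteq> arcs (free_semigroupoid X) \<times> arcs (free_semigroupoid X)"
  shows "sync_regular X R"
proof -
  interpret wf_digraph X by fact
  let ?V = "head X ` arcs X"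
  let ?H = "\<lambda>s. {a. a \<noteq> [] \<and> head X (last a) = s}"
  let ?L = "(\<lambda>(a, b). pad_pair X a b) ` R"
  let ?A = "arcs (prod_graph (pad_graph X) (pad_graph X))"
  have R: "a \<noteq> [] \<and> set a \<subseteq> arcs X \<and> b \<noteq> [] \<and> set b \<subseteq> arcs X" if "(a, b) \<in> R" for a b
    using sub that arcs_free_semigroupoidD[of a X] arcs_free_semigroupoidD[of b X] by auto
  then have V: "head X (last a) \<in> ?V \<and> head X (last b) \<in> ?V" if "(a, b) \<in> R" for a b
    using that last_in_set by blast
  have "?L = (\<Union>(s, t) \<in> ?V \<times> ?V. (\<lambda>(a, b). padded s t a b) ` (R \<inter> ?H s \<times> ?H t))"
  proof (intro equalityI subsetI)
    fix z assume "z \<in> ?L"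
    then obtain a b where ab: "z = pad_pair X a b" "(a, b) \<in> R" by auto
    let ?s = "head X (last a)" and ?t = "head X (last b)"
    have "(?s, ?t) \<in> ?V \<times> ?V" using V[OF ab(2)] by simp
    moreover have "z \<in> (\<lambda>(a, b). padded ?s ?t a b) ` (R \<inter> ?H ?s \<times> ?H ?t)"
      using ab R by (force simp: pad_pair_eq_padded)
    ultimately show "z \<in> (\<Union>(s, t) \<in> ?V \<times> ?V. (\<lambda>(a, b). padded s t a b) ` (R \<inter> ?H s \<times> ?H t))"
      by blast
  next
    fix z assume "z \<in> (\<Union>(s, t) \<in> ?V \<times> ?V. (\<lambda>(a, b). padded s t a b) ` (R \<inter> ?H s \<times> ?H t))"
    then show "z \<in> ?L"
      by (force simp: pad_pair_eq_padded)
  qed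
  moreover have "reg \<dots>"
  proof -
    \<comment> \<open>Finite unions of languages are reduced to those of relations by adding the
      empty word as a dummy second component.\<close>
    have reg_UN: "reg (\<Union>j\<in>J. M j)" if "finite J" "\<And>j. j \<in> J \<Longrightarrow> reg (M j)"
      for J :: "'c set" and M :: "'c \<Rightarrow> 'd list set"
    proof -
      have "reg (Domain (\<Union>j\<in>J. M j \<times> {[] :: unit list}))"
        using that by (intro reg_Domain sync_UN sync_Times)
          (auto intro: reg_finite_lderiv[of _ "{{}, {[]}}"] simp: lderiv_def)
      moreover have "Domain (\<Union>j\<in>J. M j \<times> {[] :: unit list}) = (\<Union>j\<in>J. M j)" by auto
      ultimately show ?thesis by simp
    qed
    show ?thesis
      using assms(2) by (intro reg_UN)
        (auto intro!: reg_padded_image sync_Int assms(4) sync_Times reg_head_last)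
  qed
  ultimately have "reg ?L" by simp
  moreover have "?L \<subseteq> lists ?A"
  proof
    fix z assume "z \<in> ?L"
    then obtain a b where ab: "z = pad_pair X a b" "(a, b) \<in> R" by auto
    have hd: "head X (last a) \<in> verts X" "head X (last b) \<in> verts X"
      using V[OF ab(2)] head_in_verts by auto
    have "set z \<subseteq> ?A"
    proof
      fix c assume c: "c \<in> set z"
      obtain c1 c2 where c12: "c = (c1, c2)" by fastforce
      have "c1 \<in> set (map Inl a @ replicate (length b - length a) (Inr (head X (last a))))"
        "c2 \<in> set (map Inl b @ replicate (length a - length b) (Inr (head X (last b))))"
        using c unfolding ab(1) pad_pair_def c12 by (blast dest: set_zip_leftD set_zip_rightD)+
      then show "c \<in> ?A"
        using hd R[OF ab(2)] by (auto simp: c12 prod_graph_def pad_graph_def split: if_splits)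
    qed
    then show "z \<in> lists ?A" by blast
  qed
  moreover have "finite ?A"
    using assms by (simp add: prod_graph_def pad_graph_def)
  ultimately show ?thesis
    unfolding sync_regular_def by (intro conjI sub regular_languageI)
qed


section \<open>Block codings\<close>

text \<open>In a local language the last letter read determines which continuations are
  allowed.\<close>

lemma reg_local:
  assumes "finite A"
  shows "reg {c. c \<noteq> [] \<and> set c \<subseteq> A \<and> hd c \<in> H \<and> last c \<in> T \<and> successively Q c}" (is "reg ?L")
proof (rule reg_finite_lderiv)
  let ?g = "\<lambda>a. {x. set x \<subseteq> A \<and> successively Q x \<and>
    (if x = [] then a \<in> T else last x \<in> T \<and> Q a (hd x))}"
  show "finite (insert ?L (insert {} (?g ` A)))"
    using assms by simp
  fix w
  show "lderiv ?L w \<in> insert ?L (insert {} (?g ` A))"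
  proof (cases "w \<noteq> [] \<and> set w \<subseteq> A \<and> hd w \<in> H \<and> successively Q w")
    case True
    then have "lderiv ?L w = ?g (last w)"
      by (auto simp: lderiv_def successively_append_iff last_append)
    moreover have "last w \<in> A"
      using True last_in_set by blast
    ultimately show ?thesis by blast
  next
    case False
    then have "w = [] \<or> lderiv ?L w = {}"
      by (auto simp: lderiv_def successively_append_iff)
    then show ?thesis by auto
  qed
qed

abbreviation unblock :: "('c \<Rightarrow> 'a list) \<Rightarrow> 'c list \<Rightarrow> 'a list" where
  "unblock b c \<equiv> concat (map b c)"

definition blocked :: "nat \<Rightarrow> ('c \<Rightarrow> 'a list) \<Rightarrow> 'c list set" where
  "blocked m b = {c. c \<noteq> [] \<and> length (b (hd c)) \<le> m \<and> (\<forall>a \<in> set (tl c). length (b a) = m)}"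

text \<open>Only the first block can fall short of \<open>m\<close>, so the total deficit is at most
  \<open>m\<close>, whatever the length of the prefix.\<close>

lemma length_unblock:
  assumes "p @ x \<in> blocked m b"
  shows "length (unblock b p) \<le> length p * m" "length p * m \<le> length (unblock b p) + m"
proof -
  have *: "length (unblock b w) = length w * m" if "\<forall>a \<in> set w. length (b a) = m" for w
    using that by (induction w) auto
  show "length (unblock b p) \<le> length p * m" "length p * m \<le> length (unblock b p) + m"
    using assms *[of "tl p"] by (cases p; simp add: blocked_def)+
qed

text \<open>When the code \<open>q\<close> has ended, the word it spells may still exceed the one
  spelled by \<open>p\<close> by up to \<open>m\<close> letters, because the first block of
  \<open>p\<close> may be short. Hence the shifted derivatives of \<open>R\<close>.\<close>

lemma fst_deriv_unblock:
  assumes "V \<subseteq> blocked m b" "V' \<subseteq> blocked m b" "length q \<le> length p"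
  shows "fst_deriv {(c, d). c \<in> V \<and> d \<in> V' \<and> (unblock b c, unblock b d) \<in> R} p q \<in>
    insert {} ((\<lambda>(D, M). {x \<in> M. unblock b x \<in> D}) `
      ({fst_deriv R p q | p q. length q \<le> length p + m} \<times> range (lderiv V)))"
    (is "?D \<in> insert {} (?f ` (?F \<times> _))")
proof (cases "lderiv V p = {} \<or> q \<notin> V'")
  case True
  then show ?thesis
    by (auto simp: fst_deriv_def lderiv_def)
next
  case False
  then obtain x where "p @ x \<in> blocked m b"
    using assms(1) by (auto simp: lderiv_def)
  moreover have "q @ [] \<in> blocked m b"
    using False assms(2) by auto
  moreover have "length q * m \<le> length p * m"
    using assms(3) by simp
  ultimately have "length (unblock b q) \<le> length (unblock b p) + m"
    using length_unblock(2)[of p x m b] length_unblock(1)[of q "[]" m b] by linarith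
  then have "fst_deriv R (unblock b p) (unblock b q) \<in> ?F"
    by blast
  moreover have "?D = ?f (fst_deriv R (unblock b p) (unblock b q), lderiv V p)"
    using False by (auto simp: fst_deriv_def lderiv_def)
  ultimately show ?thesis by blast
qed

text \<open>Two codes of equal length spell words whose lengths differ by at most \<open>m\<close>.
  A derivative is determined by the derivative of \<open>R\<close> at those two words and the
  derivatives of \<open>V\<close> and \<open>V'\<close> at the codes.\<close>

lemma sync_unblock:
  assumes R: "sync R" "R \<subseteq> lists A \<times> lists A" "finite A"
    and V: "reg V" "V \<subseteq> blocked m b" "reg V'" "V' \<subseteq> blocked m b"
  shows "sync {(c, d). c \<in> V \<and> d \<in> V' \<and> (unblock b c, unblock b d) \<in> R}" (is "sync ?R")
proof (rule syncI)
  let ?f = "\<lambda>(D, M, M'). {(x, y). x \<in> M \<and> y \<in> M' \<and> (unblock b x, unblock b y) \<in> D}"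
  let ?F = "{pair_deriv R p q | p q. length q \<le> length p + m \<and> length p \<le> length q + m}"
  show "finite (insert {} (?f ` (?F \<times> range (lderiv V) \<times> range (lderiv V'))))"
    using finite_pair_deriv_shift[OF R(1,2,3,3)] V unfolding reg_def
    by (intro finite.insertI finite_imageI[where h = ?f] finite_cartesian_product) blast+
  show "pair_deriv ?R p q \<in> insert {} (?f ` (?F \<times> range (lderiv V) \<times> range (lderiv V')))"
    if len: "length p = length q" for p q
  proof (cases "lderiv V p = {} \<or> lderiv V' q = {}")
    case True
    then have "pair_deriv ?R p q = {}"
      by (auto simp: pair_deriv_def lderiv_def)
    then show ?thesis by simp
  next
    case False
    then obtain x y where "p @ x \<in> blocked m b" "q @ y \<in> blocked m b"
      using V by (auto simp: lderiv_def)
    then have "length (unblock b q) \<le> length (unblock b p) + m"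
      "length (unblock b p) \<le> length (unblock b q) + m"
      using len length_unblock[of p x m b] length_unblock[of q y m b] by simp_all
    then have "pair_deriv R (unblock b p) (unblock b q) \<in> ?F"
      by blast
    moreover have "pair_deriv ?R p q =
        ?f (pair_deriv R (unblock b p) (unblock b q), lderiv V p, lderiv V' q)"
      by (auto simp: pair_deriv_def lderiv_def)
    ultimately show ?thesis by blast
  qed
  let ?g = "\<lambda>(D, M). {x \<in> M. unblock b x \<in> D}"
  let ?G = "\<lambda>R V. insert {} (?g `
      ({fst_deriv R p q | p q. length q \<le> length p + m} \<times> range (lderiv V)))"
  have fin: "finite (?G R V)" if "sync R" "R \<subseteq> lists A \<times> lists A" "reg V" for R V
    using finite_fst_deriv_shift[OF that(1,2) R(3)] that(3) unfolding reg_def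
    by (intro finite.insertI finite_imageI[where h = ?g] finite_cartesian_product) blast+
  show "finite (?G R V)"
    by (rule fin[OF R(1,2) V(1)])
  show "finite (?G (R\<inverse>) V')"
    by (rule fin[OF sync_converse[OF R(1)] _ V(3)]) (use R(2) in blast)
  show "fst_deriv ?R p q \<in> ?G R V" if "length q \<le> length p" for p q
    by (rule fst_deriv_unblock[OF V(2,4) that])
  show "fst_deriv (?R\<inverse>) p q \<in> ?G (R\<inverse>) V'" if "length q \<le> length p" for p q
  proof -
    have "?R\<inverse> = {(c, d). c \<in> V' \<and> d \<in> V \<and> (unblock b c, unblock b d) \<in> R\<inverse>}"
      by auto
    then show ?thesis
      using fst_deriv_unblock[OF V(4,2) that, of "R\<inverse>"] by simp
  qed
qed


section \<open>Representatives without long identity factors\<close>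

text \<open>Being a path becomes a condition on consecutive edges, so that concatenating and cutting
  are matters of \<open>successively_append_iff\<close>.\<close>

lemma (in pre_digraph) cas_iff_successively:
  "p \<noteq> [] \<Longrightarrow> cas u p v \<longleftrightarrow>
    tail G (hd p) = u \<and> head G (last p) = v \<and> successively (\<lambda>e f. head G e = tail G f) p"
proof (induction p arbitrary: u)
  case (Cons e p)
  show ?case
  proof (cases "p = []")
    case True
    show ?thesis unfolding True by simp
  next
    case False
    have "successively (\<lambda>e f. head G e = tail G f) (e # p) \<longleftrightarrow>
        head G e = tail G (hd p) \<and> successively (\<lambda>e f. head G e = tail G f) p"
      using False by (cases p) simp_all
    moreover have "cas u (e # p) v \<longleftrightarrow> tail G e = u \<and> cas (head G e) p v"
      by simp
    moreover have "last (e # p) = last p"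
      using False by simp
    ultimately show ?thesis
      unfolding list.sel using Cons.IH[OF False, of "head G e"] by metis
  qed
qed simp

lemma arcs_free_semigroupoid_iff:
  assumes "wf_digraph X"
  shows "p \<in> arcs (free_semigroupoid X) \<longleftrightarrow>
    p \<noteq> [] \<and> set p \<subseteq> arcs X \<and> successively (\<lambda>e f. head X e = tail X f) p"
proof -
  interpret wf_digraph X by fact
  have "(\<exists>u v. awalk u p v) \<longleftrightarrow> set p \<subseteq> arcs X \<and> successively (\<lambda>e f. head X e = tail X f) p"
    if "p \<noteq> []"
  proof -
    have "tail X (hd p) \<in> verts X" if "set p \<subseteq> arcs X"
      using that \<open>p \<noteq> []\<close> by (simp add: subset_iff)
    then show ?thesis
      using \<open>p \<noteq> []\<close> by (auto simp: awalk_def cas_iff_successively[OF \<open>p \<noteq> []\<close>])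
  qed
  then show ?thesis
    by (auto simp: free_semigroupoid_def)
qed

text \<open>The set of representatives is left out on purpose: it changes twice while
  \<open>X\<close> and \<open>\<rho>\<close> stay fixed.\<close>

locale represented_semigroupoid = semigroupoid S
  for S :: "('v, 'a) pre_semigroupoid" +
  fixes X :: "('v, 'e) pre_digraph" and \<rho> :: "'e list \<Rightarrow> 'a"
  assumes wf_graph: "wf_digraph X"
    and hom: "semigroupoid_hom (free_semigroupoid X) S id \<rho>"
    and surj: "\<rho> ` arcs (free_semigroupoid X) = arcs S"
begin

abbreviation paths :: "'e list set" where
  "paths \<equiv> arcs (free_semigroupoid X)"

lemmas paths_iff = arcs_free_semigroupoid_iff[OF wf_graph]

lemma rho_in_arcs: "p \<in> paths \<Longrightarrow> \<rho> p \<in> arcs S"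
  unfolding surj[symmetric] by (rule imageI)

lemma tail_rho: "p \<in> paths \<Longrightarrow> tail S (\<rho> p) = tail X (hd p)"
  and head_rho: "p \<in> paths \<Longrightarrow> head S (\<rho> p) = head X (last p)"
  using hom by (simp_all add: semigroupoid_hom_def) (simp_all add: free_semigroupoid_def)

lemma append_in_paths:
  "p \<in> paths \<Longrightarrow> q \<in> paths \<Longrightarrow> head S (\<rho> p) = tail S (\<rho> q) \<Longrightarrow> p @ q \<in> paths"
  by (simp add: tail_rho head_rho) (simp add: paths_iff successively_append_iff)

lemma append_in_pathsD:
  assumes "p @ q \<in> paths" "p \<noteq> []" "q \<noteq> []"
  shows "p \<in> paths" "q \<in> paths" "head S (\<rho> p) = tail S (\<rho> q)"
proof -
  show "p \<in> paths" "q \<in> paths"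
    using assms by (auto simp: paths_iff successively_append_iff)
  then show "head S (\<rho> p) = tail S (\<rho> q)"
    using assms by (simp add: tail_rho head_rho) (simp add: paths_iff successively_append_iff)
qed

lemma rho_append:
  assumes "p \<in> paths" "q \<in> paths" "head S (\<rho> p) = tail S (\<rho> q)"
  shows "\<rho> (p @ q) = mul S (\<rho> p) (\<rho> q)"
proof -
  have "composable (free_semigroupoid X) p q"
    using assms by (simp add: composable_def tail_rho head_rho) (simp add: free_semigroupoid_def)
  then show ?thesis
    using hom unfolding semigroupoid_hom_def by (simp add: free_semigroupoid_def)
qed

lemma rho_append':
  "p @ q \<in> paths \<Longrightarrow> p \<noteq> [] \<Longrightarrow> q \<noteq> [] \<Longrightarrow> \<rho> (p @ q) = mul S (\<rho> p) (\<rho> q)"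
  using append_in_pathsD rho_append by blast

text \<open>Multipliers are taken by arbitrary arrows, not only by edges: right multiplication in
  \<open>M\<close> by a generator \<open>(j, y, k)\<close> acts on middle entries as multiplication
  by \<open>mul S (P l j) y\<close>.\<close>

definition mult_rel :: "'e list set \<Rightarrow> 'a \<Rightarrow> ('e list \<times> 'e list) set" where
  "mult_rel K s = {(u, v) \<in> K \<times> K. head S (\<rho> u) = tail S s \<and> mul S (\<rho> u) s = \<rho> v}"

definition eq_rel :: "'e list set \<Rightarrow> ('e list \<times> 'e list) set" where
  "eq_rel K = {(u, v) \<in> K \<times> K. \<rho> u = \<rho> v}"

text \<open>Surjectivity of \<open>K\<close> provides a representative of the intermediate product,
  which serves as the middle word.\<close>

lemma mult_rel_mul:
  assumes "K \<subseteq> paths" "\<rho> ` K = arcs S" "composable S s t"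
  shows "mult_rel K (mul S s t) = mult_rel K s O mult_rel K t"
proof (intro equalityI subrelI)
  fix u w assume "(u, w) \<in> mult_rel K (mul S s t)"
  then have uw: "u \<in> K" "w \<in> K" "head S (\<rho> u) = tail S s" "mul S (\<rho> u) (mul S s t) = \<rho> w"
    using assms(3) by (auto simp: mult_rel_def tail_mul)
  have us: "composable S (\<rho> u) s"
    using uw assms rho_in_arcs by (auto simp: composable_def)
  then obtain v where v: "v \<in> K" "\<rho> v = mul S (\<rho> u) s"
    using assms(2) mul_closed by (metis imageE)
  have "mul S (\<rho> v) t = \<rho> w"
    using mul_assoc[OF us assms(3)] uw(4) v(2) by simp
  moreover have "head S (\<rho> v) = tail S t"
    using head_mul[OF us] assms(3) v(2) by (simp add: composable_def)
  ultimately show "(u, w) \<in> mult_rel K s O mult_rel K t"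
    using uw v by (auto simp: mult_rel_def)
next
  fix u w assume "(u, w) \<in> mult_rel K s O mult_rel K t"
  then obtain v where v: "u \<in> K" "v \<in> K" "w \<in> K" "head S (\<rho> u) = tail S s"
    "mul S (\<rho> u) s = \<rho> v" "mul S (\<rho> v) t = \<rho> w"
    by (auto simp: mult_rel_def)
  have "composable S (\<rho> u) s"
    using v assms rho_in_arcs by (auto simp: composable_def)
  then show "(u, w) \<in> mult_rel K (mul S s t)"
    using v assms(3) mul_assoc[of "\<rho> u" s t] by (auto simp: mult_rel_def tail_mul)
qed

lemma sync_mult_rel:
  assumes K: "K \<subseteq> paths" "\<rho> ` K = arcs S"
    and edge: "\<And>a. a \<in> arcs X \<Longrightarrow> sync (mult_rel K (\<rho> [a]))"
    and "s \<in> arcs S"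
  shows "sync (mult_rel K s)"
proof -
  have "sync (mult_rel K (\<rho> w))" if "w \<in> paths" for w
    using that
  proof (induction w)
    case (Cons a w)
    then have a: "a \<in> arcs X"
      by (simp add: paths_iff)
    show ?case
    proof (cases "w = []")
      case True
      then show ?thesis using edge[OF a] by simp
    next
      case False
      then have aw: "[a] \<in> paths" "w \<in> paths" "head S (\<rho> [a]) = tail S (\<rho> w)"
        using append_in_pathsD[of "[a]" w] Cons.prems by simp_all
      then have "mult_rel K (\<rho> (a # w)) = mult_rel K (\<rho> [a]) O mult_rel K (\<rho> w)"
        using mult_rel_mul[OF K, of "\<rho> [a]" "\<rho> w"] rho_append[OF aw] rho_in_arcs
        by (simp add: composable_def)
      then show ?thesis
        using sync_relcomp[OF edge[OF a] Cons.IH[OF aw(2)]] by simp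
    qed
  qed (simp add: paths_iff)
  then show ?thesis
    using assms(4) surj by (metis imageE)
qed

lemma mult_rel_singleton:
  assumes "K \<subseteq> paths" "a \<in> arcs X"
  shows "mult_rel K (\<rho> [a]) = edge_relation X K \<rho> a"
proof -
  have a: "[a] \<in> paths"
    using assms(2) by (simp add: paths_iff)
  have "head S (\<rho> u) = tail S (\<rho> [a]) \<and> mul S (\<rho> u) (\<rho> [a]) = \<rho> v \<longleftrightarrow>
      head X (last u) = tail X a \<and> \<rho> (u @ [a]) = \<rho> v" if "u \<in> K" for u v
    using that assms(1) a rho_append[of u "[a]"] by (auto simp: head_rho tail_rho)
  then show ?thesis
    by (auto simp: mult_rel_def edge_relation_def)
qed

text \<open>Words with a prefix \<open>p\<close> equivalent to some \<open>v \<in> K\<close> with \<open>|p| \<ge> |v| + N\<close> are discarded. No shortest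
  representative is lost: \<open>p\<close> could be pumped down while \<open>v\<close> is kept, and while the set of
  continuations of \<open>p\<close> in \<open>K\<close> is kept. If \<open>w\<close> is an identity, then \<open>p w\<close> is equivalent to its own
  prefix \<open>p\<close>, so long identity factors are gone.\<close>

lemma short_representatives:
  assumes K: "K \<subseteq> paths" "\<rho> ` K = arcs S" and Kprefix: "\<And>p w. p \<noteq> [] \<Longrightarrow> p @ w \<in> K \<Longrightarrow> p \<in> K"
    and eq: "sync (eq_rel K)"
  obtains L N where "L \<subseteq> K" "\<rho> ` L = arcs S" "reg L"
    "\<And>p w. p \<noteq> [] \<Longrightarrow> p @ w \<in> L \<Longrightarrow> p \<in> L"
    "\<And>p w. p \<noteq> [] \<Longrightarrow> w \<noteq> [] \<Longrightarrow> N \<le> length w \<Longrightarrow> p @ w \<in> L \<Longrightarrow> \<not> is_identity S (\<rho> w)"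
proof -
  \<comment> \<open>Equality of values is reflexive, so \<open>K\<close> is a projection of a
    synchronously regular relation.\<close>
  have "Domain (eq_rel K) = K"
    by (auto simp: eq_rel_def)
  then have regK: "reg K"
    using reg_Domain[OF eq] by simp
  obtain N where pump: "\<And>p v. (p, v) \<in> eq_rel K \<Longrightarrow> length v + N \<le> length p \<Longrightarrow>
      \<exists>p'. length p' < length p \<and> (p', v) \<in> eq_rel K \<and> lderiv K p' = lderiv K p"
    using sync_pumping[OF eq regK] by blast
  define D where "D = Domain (eq_rel K \<inter> {(p, v). length v + N \<le> length p})"
  define L where "L = K \<inter> - {u. \<exists>p \<in> D. prefix p u}"
  show thesis
  proof
    show "L \<subseteq> K"
      by (simp add: L_def)
    show "reg L"
      unfolding L_def D_def
      by (intro reg_Int regK reg_Compl reg_has_prefix reg_Domain sync_Int eq sync_longer)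
    show "p \<in> L" if "p \<noteq> []" "p @ w \<in> L" for p w
      using that Kprefix[of p w] by (auto simp: L_def)
    show "\<not> is_identity S (\<rho> w)" if pw: "p \<noteq> []" "w \<noteq> []" "N \<le> length w" "p @ w \<in> L" for p w
    proof
      assume "is_identity S (\<rho> w)"
      moreover have "p @ w \<in> K" "p @ w \<in> paths" "p \<in> K"
        using pw K(1) Kprefix[of p w] by (auto simp: L_def)
      ultimately have "\<rho> (p @ w) = \<rho> p"
        using append_in_pathsD[of p w] rho_append'[of p w] pw rho_in_arcs
        by (auto simp: is_identity_def composable_def)
      then have "p @ w \<in> D"
        using \<open>p @ w \<in> K\<close> \<open>p \<in> K\<close> pw(3) by (force simp: D_def eq_rel_def)
      then show False
        using pw(4) by (auto simp: L_def)
    qed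
    show "\<rho> ` L = arcs S"
    proof (intro equalityI subsetI)
      fix x assume "x \<in> arcs S"
      then have "\<exists>u. u \<in> K \<and> \<rho> u = x"
        using K(2) by (metis imageE)
      then obtain u where u: "u \<in> K" "\<rho> u = x"
        and least: "\<And>u'. u' \<in> K \<Longrightarrow> \<rho> u' = x \<Longrightarrow> length u \<le> length u'"
        using ex_has_least_nat[of "\<lambda>u. u \<in> K \<and> \<rho> u = x" _ length] by blast
      have "u \<in> L"
      proof (rule ccontr)
        assume "u \<notin> L"
        then obtain p w v where p: "(p, v) \<in> eq_rel K" "length v + N \<le> length p" "u = p @ w"
          using u(1) by (auto simp: L_def D_def prefix_def)
        then obtain p' where p': "length p' < length p" "(p', v) \<in> eq_rel K"
          "lderiv K p' = lderiv K p"
          using pump by blast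
        have in_K: "p' @ w \<in> K"
          using p' u(1) p(3) by (auto simp: lderiv_def)
        have "p \<in> K" "p' \<in> K" "\<rho> p' = \<rho> p"
          using p(1) p'(2) by (simp_all add: eq_rel_def)
        then have ne: "p \<noteq> []" "p' \<noteq> []"
          using K(1) by (auto simp: paths_iff)
        have "\<rho> (p' @ w) = \<rho> (p @ w)"
        proof (cases "w = []")
          case False
          have "p' @ w \<in> paths" "p @ w \<in> paths"
            using in_K u(1) p(3) K(1) by blast+
          then show ?thesis
            using rho_append'[of p' w] rho_append'[of p w] ne False \<open>\<rho> p' = \<rho> p\<close> by simp
        qed (simp add: \<open>\<rho> p' = \<rho> p\<close>)
        then have "length u \<le> length (p' @ w)"
          using least[OF in_K] u(2) p(3) by simp
        then show False
          using p'(1) p(3) by simp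
      qed
      then show "x \<in> \<rho> ` L"
        using u(2) by blast
    qed (use K rho_in_arcs in \<open>auto simp: L_def\<close>)
  qed
qed

lemma sync_restrict:
  assumes "L \<subseteq> K" "reg L"
  shows "sync (eq_rel K) \<Longrightarrow> sync (eq_rel L)" "sync (mult_rel K s) \<Longrightarrow> sync (mult_rel L s)"
proof -
  have "eq_rel L = eq_rel K \<inter> L \<times> L" "mult_rel L s = mult_rel K s \<inter> L \<times> L"
    using assms(1) unfolding eq_rel_def mult_rel_def by blast+
  then show "sync (eq_rel K) \<Longrightarrow> sync (eq_rel L)" "sync (mult_rel K s) \<Longrightarrow> sync (mult_rel L s)"
    by (simp_all add: sync_Int sync_Times assms(2))
qed

end

text \<open>The relation between \<open>K\<close> and its prefixes links each prefix to a
  representative in \<open>K\<close> of the same value. Composing with it on both sides transfers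
  equality and multipliers from \<open>K\<close> to \<open>Pref K\<close>, where
  \<open>short_representatives\<close> applies.\<close>

lemma prefix_automatic_structure_imp_normal_form:
  assumes S: "semigroupoid S" and struct: "prefix_automatic_structure S X K \<rho>"
  obtains L N where "represented_semigroupoid S X \<rho>" "finite (arcs X)"
    "L \<subseteq> arcs (free_semigroupoid X)" "\<rho> ` L = arcs S"
    "sync (represented_semigroupoid.eq_rel \<rho> L)"
    "\<And>s. s \<in> arcs S \<Longrightarrow> sync (represented_semigroupoid.mult_rel S \<rho> L s)"
    "\<And>p w. p \<noteq> [] \<Longrightarrow> p @ w \<in> L \<Longrightarrow> p \<in> L"
    "\<And>p w. p \<noteq> [] \<Longrightarrow> w \<noteq> [] \<Longrightarrow> N \<le> length w \<Longrightarrow> p @ w \<in> L \<Longrightarrow> \<not> is_identity S (\<rho> w)"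
proof -
  have choice: "choice_of_representatives S X K \<rho>" and fin: "finite (arcs X)"
    and edge: "\<And>a. a \<in> arcs X \<Longrightarrow> sync_regular X (edge_relation X K \<rho> a)"
    and pref: "sync_regular X {(u, v) \<in> K \<times> Pref K. \<rho> u = \<rho> v}"
    using struct by (simp_all add: prefix_automatic_structure_def automatic_structure_def
        fg_choice_of_representatives_def)
  interpret semigroupoid S by (rule S)
  have K: "K \<subseteq> arcs (free_semigroupoid X)" "\<rho> ` K = arcs S"
    using choice by (simp_all add: choice_of_representatives_def)
  have rep: "represented_semigroupoid S X \<rho>"
    using choice S
    by (simp add: choice_of_representatives_def represented_semigroupoid_def
        represented_semigroupoid_axioms_def)
  interpret represented_semigroupoid S X \<rho> by (rule rep)
  let ?R = "{(u, v) \<in> K \<times> Pref K. \<rho> u = \<rho> v}"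
  have R: "sync ?R"
    by (rule sync_regular_imp_sync[OF fin pref])
  have PK: "Pref K \<subseteq> paths"
    using K(1) append_in_pathsD(1) by (fastforce simp: Pref_def prefix_def)
  have "K \<subseteq> Pref K"
    using K(1) by (auto simp: Pref_def paths_iff)
  then have PKS: "\<rho> ` Pref K = arcs S"
    using K(2) PK rho_in_arcs by blast
  have rep_K: "\<exists>k \<in> K. \<rho> k = \<rho> u" if "u \<in> Pref K" for u
    using that PK K(2) rho_in_arcs by (metis imageE subsetD)
  have "eq_rel (Pref K) = ?R\<inverse> O ?R"
    using rep_K by (auto simp: eq_rel_def relcomp_unfold) metis
  then have eq: "sync (eq_rel (Pref K))"
    using R by (simp add: sync_relcomp sync_converse)
  have "sync (mult_rel (Pref K) (\<rho> [a]))" if a: "a \<in> arcs X" for a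
  proof -
    have "mult_rel (Pref K) (\<rho> [a]) = ?R\<inverse> O mult_rel K (\<rho> [a]) O ?R" (is "?A = ?B")
    proof (intro equalityI subrelI)
      fix u v assume "(u, v) \<in> ?A"
      then have uv: "u \<in> Pref K" "v \<in> Pref K" "head S (\<rho> u) = tail S (\<rho> [a])"
        "mul S (\<rho> u) (\<rho> [a]) = \<rho> v"
        by (auto simp: mult_rel_def)
      obtain k l where kl: "k \<in> K" "\<rho> k = \<rho> u" "l \<in> K" "\<rho> l = \<rho> v"
        using rep_K uv by blast
      then have "(u, k) \<in> ?R\<inverse>" "(k, l) \<in> mult_rel K (\<rho> [a])" "(l, v) \<in> ?R"
        using uv by (auto simp: mult_rel_def)
      then show "(u, v) \<in> ?B" by blast
    qed (auto simp: mult_rel_def)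
    moreover have "sync (mult_rel K (\<rho> [a]))"
      using sync_regular_imp_sync[OF fin edge[OF a]] mult_rel_singleton[OF K(1) a] by simp
    ultimately show ?thesis
      using R by (simp add: sync_relcomp sync_converse)
  qed
  then have mult: "sync (mult_rel (Pref K) s)" if "s \<in> arcs S" for s
    using sync_mult_rel[OF PK PKS _ that] by blast
  have closed: "p \<in> Pref K" if "p \<noteq> []" "p @ w \<in> Pref K" for p w
    using that by (auto simp: Pref_def dest: append_prefixD)
  show thesis
  proof (rule short_representatives[OF PK PKS closed eq])
    fix L N
    assume L: "L \<subseteq> Pref K" "\<rho> ` L = arcs S" "reg L"
      "\<And>p w. p \<noteq> [] \<Longrightarrow> p @ w \<in> L \<Longrightarrow> p \<in> L"
      "\<And>p w. p \<noteq> [] \<Longrightarrow> w \<noteq> [] \<Longrightarrow> N \<le> length w \<Longrightarrow> p @ w \<in> L \<Longrightarrow> \<not> is_identity S (\<rho> w)"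
    have "L \<subseteq> paths"
      using L(1) PK by (rule subset_trans)
    moreover have "sync (eq_rel L)"
      by (rule sync_restrict(1)[OF L(1,3) eq])
    moreover have "sync (mult_rel L s)" if "s \<in> arcs S" for s
      by (rule sync_restrict(2)[OF L(1,3) mult[OF that]])
    ultimately show thesis
      using that[OF rep fin _ L(2) _ _ L(4,5)] by simp
  qed
qed


section \<open>Rees matrix semigroups\<close>

context rees_matrix_data
begin

abbreviation M :: "(unit, 'i \<times> 'a \<times> 'l) pre_semigroupoid" where
  "M \<equiv> rees_matrix_semigroup S I \<Lambda> F G P"

lemma arcs_M_iff:
  "(i, x, l) \<in> arcs M \<longleftrightarrow> i \<in> I \<and> x \<in> arcs S \<and> l \<in> \<Lambda> \<and> F i = tail S x \<and> head S x = G l"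
  by (simp add: rees_matrix_semigroup_def)

lemma mul_M: "mul M (i, x, l) (j, y, k) = (i, mul S (mul S x (P l j)) y, k)"
  by (simp add: rees_matrix_semigroup_def)

lemma composable_P:
  assumes "(i, x, l) \<in> arcs M" "(j, y, k) \<in> arcs M"
  shows "composable S x (P l j)" "composable S (P l j) y" "composable S (mul S x (P l j)) y"
proof -
  show *: "composable S x (P l j)" "composable S (P l j) y"
    using assms by (simp_all add: arcs_M_iff composable_def P_arrow tail_P head_P)
  then show "composable S (mul S x (P l j)) y"
    using mul_closed[OF *(1)] head_mul[OF *(1)] by (simp add: composable_def)
qed

lemma mul_M_closed: "a \<in> arcs M \<Longrightarrow> b \<in> arcs M \<Longrightarrow> mul M a b \<in> arcs M"
proof (cases a, cases b)
  fix i x l j y k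
  assume "a \<in> arcs M" "b \<in> arcs M" and ab: "a = (i, x, l)" "b = (j, y, k)"
  then have *: "(i, x, l) \<in> arcs M" "(j, y, k) \<in> arcs M" by simp_all
  note c = composable_P[OF *]
  show ?thesis
    using * mul_closed[OF c(3)] tail_mul[OF c(3)] head_mul[OF c(3)] tail_mul[OF c(1)]
    unfolding ab mul_M arcs_M_iff by simp
qed

lemma mul_M_assoc:
  "a \<in> arcs M \<Longrightarrow> b \<in> arcs M \<Longrightarrow> c \<in> arcs M \<Longrightarrow> mul M a (mul M b c) = mul M (mul M a b) c"
proof (cases a, cases b, cases c)
  fix i x l j y k n z h
  assume "a \<in> arcs M" "b \<in> arcs M" "c \<in> arcs M"
    and abc: "a = (i, x, l)" "b = (j, y, k)" "c = (n, z, h)"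
  then have *: "(i, x, l) \<in> arcs M" "(j, y, k) \<in> arcs M" "(n, z, h) \<in> arcs M" by simp_all
  note c1 = composable_P[OF *(1,2)] and c2 = composable_P[OF *(2,3)]
  let ?u = "mul S x (P l j)"
  have "composable S ?u (mul S y (P k n))"
    using c1(3) mul_closed[OF c2(1)] tail_mul[OF c2(1)] by (simp add: composable_def)
  then have "mul S ?u (mul S (mul S y (P k n)) z) = mul S (mul S ?u (mul S y (P k n))) z"
    using mul_assoc c2(3) by blast
  also have "mul S ?u (mul S y (P k n)) = mul S (mul S ?u y) (P k n)"
    by (rule mul_assoc[OF c1(3) c2(1)])
  finally show ?thesis
    unfolding abc mul_M by simp
qed

lemma semigroupoid_M: "semigroupoid M"
proof
  show "composable M a b \<Longrightarrow> mul M a b \<in> arcs M" for a b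
    by (simp add: composable_def mul_M_closed)
  show "composable M a b \<Longrightarrow> composable M b c \<Longrightarrow> mul M a (mul M b c) = mul M (mul M a b) c" for a b c
    by (simp add: composable_def mul_M_assoc)
qed (auto simp: rees_matrix_semigroup_def pre_digraph.truncate_def)

text \<open>A product in \<open>M\<close> keeps the first index of its first factor and the last
  index of its last, so no indices occur besides those of the generators. Every index does occur in
  an element of \<open>M\<close>, by surjectivity of \<open>F\<close> and \<open>G\<close>.\<close>

lemma finite_index_sets:
  assumes "finitely_generated M"
  shows "finite I" "finite \<Lambda>"
proof -
  obtain Y :: "(unit, nat) pre_digraph" and K \<sigma>
    where choice: "choice_of_representatives M Y K \<sigma>" and fin: "finite (arcs Y)"
    using assms by (auto simp: finitely_generated_def fg_choice_of_representatives_def)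
  interpret Y: represented_semigroupoid M Y \<sigma>
    using choice semigroupoid_M by (simp add: choice_of_representatives_def
        represented_semigroupoid_def represented_semigroupoid_axioms_def)
  have first: "fst (mul M a b) = fst a" and last: "snd (snd (mul M a b)) = snd (snd b)" for a b
    by (cases a, cases b, simp add: mul_M)+
  have ends: "fst (\<sigma> w) = fst (\<sigma> [hd w]) \<and> snd (snd (\<sigma> w)) = snd (snd (\<sigma> [last w]))"
    if w: "w \<in> Y.paths" for w
  proof
    have ne: "w \<noteq> []" using w by (simp add: Y.paths_iff)
    then obtain a v where "w = [a] @ v" by (cases w) simp_all
    then show "fst (\<sigma> w) = fst (\<sigma> [hd w])"
      using Y.rho_append'[of "[a]" v] w first by (cases "v = []") simp_all
    obtain a v where "w = v @ [a]" using ne by (cases w rule: rev_cases) simp_all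
    then show "snd (snd (\<sigma> w)) = snd (snd (\<sigma> [last w]))"
      using Y.rho_append'[of v "[a]"] w last by (cases "v = []") simp_all
  qed
  have arrow: "fst a \<in> (\<lambda>e. fst (\<sigma> [e])) ` arcs Y \<and> snd (snd a) \<in> (\<lambda>e. snd (snd (\<sigma> [e]))) ` arcs Y"
    if "a \<in> arcs M" for a
  proof -
    have "a \<in> \<sigma> ` Y.paths"
      using that Y.surj by simp
    then obtain w where w: "w \<in> Y.paths" "a = \<sigma> w"
      by blast
    then have "hd w \<in> arcs Y" "last w \<in> arcs Y"
      unfolding Y.paths_iff using hd_in_set last_in_set by blast+
    then show ?thesis
      using ends[OF w(1)] w(2) by auto
  qed
  have "I \<subseteq> (\<lambda>e. fst (\<sigma> [e])) ` arcs Y"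
  proof
    fix i assume i: "i \<in> I"
    then obtain x where x: "x \<in> arcs S" "F i = tail S x"
      using F_surj by (metis imageE imageI)
    then obtain l where "l \<in> \<Lambda>" "head S x = G l"
      using G_surj by (metis imageE imageI)
    then show "i \<in> (\<lambda>e. fst (\<sigma> [e])) ` arcs Y"
      using arrow[of "(i, x, l)"] i x by (simp add: arcs_M_iff)
  qed
  then show "finite I"
    by (rule finite_surj[OF fin])
  have "\<Lambda> \<subseteq> (\<lambda>e. snd (snd (\<sigma> [e]))) ` arcs Y"
  proof
    fix l assume l: "l \<in> \<Lambda>"
    then obtain x where x: "x \<in> arcs S" "head S x = G l"
      using G_surj by (metis imageE imageI)
    then obtain i where "i \<in> I" "F i = tail S x"
      using F_surj by (metis imageE imageI)
    then show "l \<in> (\<lambda>e. snd (snd (\<sigma> [e]))) ` arcs Y"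
      using arrow[of "(i, x, l)"] l x by (simp add: arcs_M_iff)
  qed
  then show "finite \<Lambda>"
    by (rule finite_surj[OF fin])
qed

end

text \<open>A representative \<open>u \<in> K\<close> of \<open>x\<close> is cut into blocks \<open>u\<^sub>1, ..., u\<^sub>k\<close>, all of length \<open>m\<close> except that
  \<open>u\<^sub>1\<close> may be shorter; with the short block in front, prefixes of codes are codes. Each later block
  \<open>u\<^sub>j\<close> evaluates to \<open>P l i\<^sub>j * s\<^sub>j\<close>, where \<open>l \<in> \<Lambda>'\<close> is determined by the source of \<open>u\<^sub>j\<close>, so that
  \<open>(i, x, l\<^sub>k)\<close> is the product of \<open>(i, u\<^sub>1, l\<^sub>1)\<close>, \<open>(i\<^sub>2, s\<^sub>2, l\<^sub>2)\<close>, ..., \<open>(i\<^sub>k, s\<^sub>k, l\<^sub>k)\<close>. The letter for the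
  first factor is \<open>(Some i, u\<^sub>1, l\<^sub>1)\<close>, those for the others are \<open>(None, u\<^sub>j, l\<^sub>j)\<close>.\<close>

locale rees_block_coding =
  rees_matrix_data S I \<Lambda> F G P + represented_semigroupoid S X \<rho>
  for S :: "('v, 'a) pre_semigroupoid" and I :: "'i set" and \<Lambda> :: "'l set"
    and F :: "'i \<Rightarrow> 'v" and G :: "'l \<Rightarrow> 'v" and P :: "'l \<Rightarrow> 'i \<Rightarrow> 'a"
    and X :: "('v, 'e) pre_digraph" and \<rho> :: "'e list \<Rightarrow> 'a" +
  fixes K :: "'e list set" and m :: nat and \<Lambda>' :: "'l set"
  assumes finite_I: "finite I" and finite_\<Lambda>: "finite \<Lambda>" and finite_X: "finite (arcs X)"
    and K_paths: "K \<subseteq> paths" and K_surj: "\<rho> ` K = arcs S"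
    and K_eq: "sync (eq_rel K)" and K_mult: "s \<in> arcs S \<Longrightarrow> sync (mult_rel K s)"
    and K_prefix: "p \<noteq> [] \<Longrightarrow> p @ w \<in> K \<Longrightarrow> p \<in> K"
    and m_pos: "0 < m"
    and cross_section: "\<Lambda>' \<subseteq> \<Lambda>" "bij_betw G \<Lambda>' (head S ` arcs S)"
    and block: "p \<noteq> [] \<Longrightarrow> length w = m \<Longrightarrow> p @ w \<in> K \<Longrightarrow>
      \<exists>l \<in> \<Lambda>'. \<exists>i \<in> I. \<exists>s. composable S (P l i) s \<and> \<rho> w = mul S (P l i) s"
begin

section \<open>Letters and their values\<close>

definition factors :: "'e list \<Rightarrow> 'l \<Rightarrow> 'i \<times> 'a \<Rightarrow> bool" where
  "factors u l = (\<lambda>(i, s). i \<in> I \<and> composable S (P l i) s \<and> \<rho> u = mul S (P l i) s)"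

text \<open>One factorisation is fixed for each word, without reference to what precedes it, so
  finitely many blocks yield finitely many arrows \<open>s\<close>.\<close>

definition factor :: "'e list \<Rightarrow> 'i \<times> 'a" where
  "factor u = (SOME z. \<exists>l \<in> \<Lambda>'. factors u l z)"

definition letters :: "('i option \<times> 'e list \<times> 'l) set" where
  "letters =
    {(z, u, l). u \<in> paths \<and> l \<in> \<Lambda> \<and> head S (\<rho> u) = G l \<and>
      (case z of Some i \<Rightarrow> i \<in> I \<and> length u \<le> m \<and> F i = tail S (\<rho> u)
       | None \<Rightarrow> length u = m \<and> (\<exists>l \<in> \<Lambda>'. \<exists>z. factors u l z))}"

fun letter_value :: "'i option \<times> 'e list \<times> 'l \<Rightarrow> 'i \<times> 'a \<times> 'l" where
  "letter_value (Some i, u, l) = (i, \<rho> u, l)"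
| "letter_value (None, u, l) = (fst (factor u), snd (factor u), l)"

lemma finite_letters: "finite letters"
proof (rule finite_subset)
  have "paths \<subseteq> lists (arcs X)"
    by (auto simp: paths_iff)
  then show "letters \<subseteq> insert None (Some ` I) \<times> {u. u \<in> lists (arcs X) \<and> length u \<le> m} \<times> \<Lambda>"
    by (auto simp: letters_def split: option.splits)
  show "finite (insert None (Some ` I) \<times> {u. u \<in> lists (arcs X) \<and> length u \<le> m} \<times> \<Lambda>)"
    using finite_I finite_\<Lambda> finite_lists_le[OF finite_X] by blast
qed

text \<open>The row chosen inside \<open>factor\<close> must have the source of \<open>u\<close> as
  its \<open>G\<close>-value, and \<open>G\<close> is injective on
  \<open>\<Lambda>'\<close>.\<close>

lemma factors_factor:
  assumes "\<exists>l \<in> \<Lambda>'. \<exists>z. factors u l z" "l \<in> \<Lambda>'" "G l = tail S (\<rho> u)"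
  shows "factors u l (factor u)"
proof -
  obtain k where k: "k \<in> \<Lambda>'" "factors u k (factor u)"
    using assms(1) someI_ex[of "\<lambda>z. \<exists>l \<in> \<Lambda>'. factors u l z"] unfolding factor_def by blast
  obtain i s where dec: "i \<in> I" "composable S (P k i) s" "\<rho> u = mul S (P k i) s"
    using k(2) by (auto simp: factors_def)
  have "G k = tail S (P k i)"
    using tail_P[of k i] k(1) cross_section(1) dec(1) by auto
  also have "\<dots> = G l"
    using tail_mul[OF dec(2)] dec(3) assms(3) by simp
  finally have "k = l"
    using cross_section(2) k(1) assms(2) by (auto simp: bij_betw_def inj_on_def)
  then show ?thesis
    using k(2) by simp
qed

text \<open>Here \<open>k\<close> plays the label of the preceding letter: the product in
  \<open>M\<close> inserts row \<open>k\<close> of \<open>P\<close>, and this restores the value of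
  the block.\<close>

lemma letter_value_None:
  assumes "(None, u, l) \<in> letters" "k \<in> \<Lambda>'" "G k = tail S (\<rho> u)"
  shows "composable S (P k (fst (factor u))) (snd (factor u))"
    "mul S (P k (fst (factor u))) (snd (factor u)) = \<rho> u"
    "(fst (factor u), snd (factor u), l) \<in> arcs M"
proof -
  have u: "\<exists>l \<in> \<Lambda>'. \<exists>z. factors u l z" "l \<in> \<Lambda>" "head S (\<rho> u) = G l"
    using assms(1) by (auto simp: letters_def)
  note f = factors_factor[OF u(1) assms(2,3)]
  show c: "composable S (P k (fst (factor u))) (snd (factor u))"
    and e: "mul S (P k (fst (factor u))) (snd (factor u)) = \<rho> u"
    using f by (auto simp: factors_def split: prod.splits)
  have i: "fst (factor u) \<in> I"
    using f by (auto simp: factors_def split: prod.splits)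
  have "k \<in> \<Lambda>"
    using assms(2) cross_section(1) by blast
  then show "(fst (factor u), snd (factor u), l) \<in> arcs M"
    using i c head_mul[OF c] e u head_P[of k "fst (factor u)"]
    by (simp add: arcs_M_iff composable_def)
qed

lemma letter_value_in_arcs:
  assumes "a \<in> letters"
  shows "letter_value a \<in> arcs M"
proof (cases a)
  case (fields z u l)
  show ?thesis
  proof (cases z)
    case None
    obtain k y where k: "k \<in> \<Lambda>'" "factors u k y"
      using assms fields None by (auto simp: letters_def)
    then obtain i s where dec: "i \<in> I" "composable S (P k i) s" "\<rho> u = mul S (P k i) s"
      by (auto simp: factors_def)
    have "G k = tail S (\<rho> u)"
      using tail_mul[OF dec(2)] dec k(1) cross_section(1) tail_P[of k i] by auto
    then show ?thesis
      using letter_value_None(3)[of u l k] assms k(1) fields None by simp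
  qed (use assms fields in \<open>auto simp: letters_def arcs_M_iff rho_in_arcs\<close>)
qed

text \<open>The letters are numbered because \<open>prefix_automatic\<close> wants natural numbers
  as edges.\<close>

definition letter :: "nat \<Rightarrow> 'i option \<times> 'e list \<times> 'l" where
  "letter = (SOME h. bij_betw h {0..<card letters} letters)"

definition alphabet :: "nat set" where
  "alphabet = {0..<card letters}"

lemma image_letter: "letter ` alphabet = letters"
proof -
  have "bij_betw letter {0..<card letters} letters"
    unfolding letter_def by (rule someI_ex[OF ex_bij_betw_nat_finite[OF finite_letters]])
  then show ?thesis
    by (simp add: bij_betw_def alphabet_def)
qed

lemma finite_alphabet: "finite alphabet"
  by (simp add: alphabet_def)

section \<open>Codes and the elements they represent\<close>

abbreviation word :: "nat \<Rightarrow> 'e list" where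
  "word a \<equiv> fst (snd (letter a))"

abbreviation label :: "nat \<Rightarrow> 'l" where
  "label a \<equiv> snd (snd (letter a))"

text \<open>All labels but the last are thereby forced: each is the row of the cross-section that
  belongs to the source of the next block. The last label is free in
  \<open>\<Lambda>\<close>.\<close>

definition follows :: "nat \<Rightarrow> nat \<Rightarrow> bool" where
  "follows a a' \<longleftrightarrow> fst (letter a') = None \<and> label a \<in> \<Lambda>' \<and> G (label a) = tail S (\<rho> (word a'))"

text \<open>Shaped to match \<open>reg_local\<close>. Membership of the spelled word in
  \<open>K\<close> is imposed only later, through relations on \<open>K\<close>.\<close>

definition codes :: "'i \<Rightarrow> 'l \<Rightarrow> nat list set" where
  "codes i l = {c. c \<noteq> [] \<and> set c \<subseteq> alphabet \<and> hd c \<in> {a. fst (letter a) = Some i} \<and>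
     last c \<in> {a. label a = l} \<and> successively follows c}"

definition evaluate :: "nat list \<Rightarrow> 'i \<times> 'a \<times> 'l" where
  "evaluate c = foldl (mul M) (letter_value (letter (hd c))) (map (letter_value \<circ> letter) (tl c))"

lemma codes_singleton:
  "[a] \<in> codes i l \<longleftrightarrow> a \<in> alphabet \<and> fst (letter a) = Some i \<and> label a = l"
  by (auto simp: codes_def)

lemma codes_snoc:
  "c \<noteq> [] \<Longrightarrow> c @ [a] \<in> codes i l \<longleftrightarrow>
    c \<in> codes i (label (last c)) \<and> a \<in> alphabet \<and> follows (last c) a \<and> label a = l"
  by (auto simp: codes_def successively_append_iff)

lemma evaluate_singleton [simp]: "evaluate [a] = letter_value (letter a)"
  by (simp add: evaluate_def)

lemma evaluate_snoc: "c \<noteq> [] \<Longrightarrow> evaluate (c @ [a]) = mul M (evaluate c) (letter_value (letter a))"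
  by (simp add: evaluate_def)

lemma alphabet_in_letters: "a \<in> alphabet \<Longrightarrow> letter a \<in> letters"
  using image_letter by blast

lemma evaluate_in_arcs: "c \<noteq> [] \<Longrightarrow> set c \<subseteq> alphabet \<Longrightarrow> evaluate c \<in> arcs M"
proof (induction c rule: rev_induct)
  case (snoc a c)
  then show ?case
    by (cases "c = []")
      (simp_all add: evaluate_snoc mul_M_closed letter_value_in_arcs alphabet_in_letters)
qed simp

lemma evaluate_append:
  assumes "c \<noteq> []" "set c \<subseteq> alphabet"
  shows "d \<noteq> [] \<Longrightarrow> set d \<subseteq> alphabet \<Longrightarrow> evaluate (c @ d) = mul M (evaluate c) (evaluate d)"
proof (induction d rule: rev_induct)
  case (snoc a d)
  show ?case
  proof (cases "d = []")
    case True
    then show ?thesis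
      using evaluate_snoc[OF assms(1)] by simp
  next
    case False
    then have "evaluate (c @ d) = mul M (evaluate c) (evaluate d)"
      using snoc by simp
    then show ?thesis
      using evaluate_snoc[of "c @ d" a] evaluate_snoc[OF False, of a] assms snoc.prems False
        mul_M_assoc[of "evaluate c" "evaluate d" "letter_value (letter a)"]
      by (simp add: evaluate_in_arcs letter_value_in_arcs alphabet_in_letters)
  qed
qed simp

lemma codesD:
  assumes "c \<in> codes i l"
  shows "unblock word c \<in> paths \<and> tail S (\<rho> (unblock word c)) = F i \<and>
    head S (\<rho> (unblock word c)) = G l \<and> evaluate c = (i, \<rho> (unblock word c), l)"
  using assms
proof (induction c arbitrary: l rule: rev_induct)
  case Nil
  then show ?case by (simp add: codes_def)
next
  case (snoc a c)
  have a: "letter a \<in> letters" "label a = l"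
    using snoc.prems alphabet_in_letters by (auto simp: codes_def)
  show ?case
  proof (cases "c = []")
    case True
    then obtain w where la: "letter a = (Some i, w, l)"
      using snoc.prems codes_singleton[of a i l] by (cases "letter a") auto
    then have "(Some i, w, l) \<in> letters"
      using a(1) by simp
    then show ?thesis
      using True la by (auto simp: letters_def)
  next
    case False
    let ?u = "unblock word c" and ?k = "label (last c)"
    have c: "c \<in> codes i ?k" and f: "follows (last c) a"
      using snoc.prems codes_snoc[OF False] by auto
    note IH = snoc.IH[OF c]
    obtain w where la: "letter a = (None, w, l)"
      using f a(2) by (cases "letter a") (auto simp: follows_def)
    then have la': "(None, w, l) \<in> letters"
      using a(1) by simp
    have k: "?k \<in> \<Lambda>'" "G ?k = tail S (\<rho> w)"
      using f la by (auto simp: follows_def)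
    have w: "w \<in> paths" "head S (\<rho> w) = G l"
      using la' by (auto simp: letters_def)
    have u: "?u \<in> paths" "head S (\<rho> ?u) = tail S (\<rho> w)"
      using IH k(2) by simp_all
    note v = letter_value_None[OF la' k]
    have arc: "(i, \<rho> ?u, ?k) \<in> arcs M"
      using evaluate_in_arcs[OF False] IH c by (simp add: codes_def)
    note comp = composable_P[OF arc v(3)]
    have ap: "\<rho> (?u @ w) = mul S (\<rho> ?u) (\<rho> w)"
      by (rule rho_append[OF u(1) w(1) u(2)])
    have cu: "composable S (\<rho> ?u) (\<rho> w)"
      using u w by (simp add: composable_def rho_in_arcs)
    have "evaluate (c @ [a]) = mul M (i, \<rho> ?u, ?k) (fst (factor w), snd (factor w), l)"
      using evaluate_snoc[OF False, of a] IH la by simp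
    \<comment> \<open>Reassociation brings the inserted entry of \<open>P\<close> next to
      \<open>snd (factor w)\<close>, and together they give \<open>\<rho> w\<close>.\<close>
    also have "\<dots> = (i, \<rho> (?u @ w), l)"
      unfolding mul_M ap using mul_assoc[OF comp(1,2)] v(2) by simp
    finally have "evaluate (c @ [a]) = (i, \<rho> (?u @ w), l)" .
    moreover have "?u @ w \<in> paths"
      by (rule append_in_paths[OF u(1) w(1) u(2)])
    moreover have "tail S (\<rho> (?u @ w)) = F i" "head S (\<rho> (?u @ w)) = G l"
      using tail_mul[OF cu] head_mul[OF cu] IH w(2) ap by simp_all
    ultimately show ?thesis
      using la by simp
  qed
qed

lemma codes_subset_blocked: "codes i l \<subseteq> blocked m word"
proof
  fix c assume c: "c \<in> codes i l"
  then obtain a d where ad: "c = a # d"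
    by (cases c) (auto simp: codes_def)
  have "fst (letter b) = None" if "successively follows (a # d)" "b \<in> set d" for a b d
    using that
  proof (induction d arbitrary: a)
    case (Cons e d)
    have "follows a e" "successively follows (e # d)"
      using Cons.prems(1) by simp_all
    then show ?case
      using Cons.IH[of e] Cons.prems(2) by (cases "b = e") (simp_all add: follows_def)
  qed simp
  then have none: "\<forall>b \<in> set d. fst (letter b) = None"
    using c ad unfolding codes_def by blast
  have "length (word b) = m" if "b \<in> alphabet" "fst (letter b) = None" for b
    using alphabet_in_letters[OF that(1)] that(2) by (cases "letter b") (auto simp: letters_def)
  then have "\<forall>b \<in> set d. length (word b) = m"
    using c ad none by (auto simp: codes_def)
  moreover have "length (word a) \<le> m"
    using c ad alphabet_in_letters[of a] by (cases "letter a") (auto simp: codes_def letters_def)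
  ultimately show "c \<in> blocked m word"
    using ad by (simp add: blocked_def)
qed

lemma reg_codes: "reg (codes i l)"
  unfolding codes_def by (rule reg_local[OF finite_alphabet])

text \<open>Blocks are cut off at the end, so what remains is a prefix and stays in
  \<open>K\<close>; the remainder of length at most \<open>m\<close> becomes the opening
  letter.\<close>

lemma ex_code:
  assumes "u \<in> K" "i \<in> I" "l \<in> \<Lambda>" "F i = tail S (\<rho> u)" "head S (\<rho> u) = G l"
  shows "\<exists>c \<in> codes i l. unblock word c = u"
  using assms
proof (induction "length u" arbitrary: u l rule: less_induct)
  case less
  have u: "u \<in> paths"
    using less.prems K_paths by blast
  show ?case
  proof (cases "length u \<le> m")
    case True
    then have "(Some i, u, l) \<in> letters"
      using less.prems u True by (simp add: letters_def)
    then obtain a where "a \<in> alphabet" "letter a = (Some i, u, l)"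
      using image_letter by (metis imageE)
    then show ?thesis
      by (intro bexI[where x = "[a]"]) (simp_all add: codes_singleton)
  next
    case False
    define p w where "p = take (length u - m) u" and "w = drop (length u - m) u"
    have pw: "u = p @ w" "p \<noteq> []" "length w = m" "w \<noteq> []" "length p < length u"
      using False m_pos by (auto simp: p_def w_def)
    have K: "p @ w \<in> K" "p \<in> K"
      using less.prems(1) pw(1,2) K_prefix[of p w] by simp_all
    note sub = append_in_pathsD[OF u[unfolded pw(1)] pw(2,4)]
    note ap = rho_append[OF sub]
    have c: "composable S (\<rho> p) (\<rho> w)"
      using sub rho_in_arcs by (simp add: composable_def)
    have "head S (\<rho> p) \<in> head S ` arcs S"
      using sub(1) rho_in_arcs by blast
    \<comment> \<open>The new last label of the remainder is the cross-section row at the cut, as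
      \<open>follows\<close> requires.\<close>
    then obtain k where k: "k \<in> \<Lambda>'" "G k = head S (\<rho> p)"
      using cross_section(2) by (metis bij_betw_imp_surj_on imageE)
    have "F i = tail S (\<rho> p)"
      using tail_mul[OF c] ap pw(1) less.prems(4) by simp
    then obtain d where d: "d \<in> codes i k" "unblock word d = p"
      using less.hyps[OF pw(5) K(2) less.prems(2), of k] k cross_section(1) by auto
    have "\<exists>l \<in> \<Lambda>'. \<exists>z. factors w l z"
      using block[OF pw(2,3) K(1)] by (fastforce simp: factors_def)
    moreover have "head S (\<rho> w) = G l"
      using head_mul[OF c] ap pw(1) less.prems(5) by simp
    ultimately have "(None, w, l) \<in> letters"
      using less.prems(3) sub(2) pw(3) by (simp add: letters_def)
    then obtain a where a: "a \<in> alphabet" "letter a = (None, w, l)"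
      using image_letter by (metis imageE)
    have "d \<noteq> []" "label (last d) = k"
      using d(1) by (auto simp: codes_def)
    then have "d @ [a] \<in> codes i l"
      using codes_snoc[of d a i l] d a k sub(3) by (simp add: follows_def)
    then show ?thesis
      using d a pw(1) by (intro bexI[where x = "d @ [a]"]) simp_all
  qed
qed

section \<open>The prefix-automatic structure on the Rees matrix semigroup\<close>

definition representatives :: "nat list set" where
  "representatives = (\<Union>i \<in> I. \<Union>l \<in> \<Lambda>. {c \<in> codes i l. unblock word c \<in> K})"

definition generators :: "(unit, nat) pre_digraph" where
  "generators = \<lparr>verts = {()}, arcs = alphabet, tail = \<lambda>_. (), head = \<lambda>_. ()\<rparr>"

lemma wf_generators: "wf_digraph generators"
  by unfold_locales (simp_all add: generators_def)

lemma generator_paths_iff: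
  "c \<in> arcs (free_semigroupoid generators) \<longleftrightarrow> c \<noteq> [] \<and> set c \<subseteq> alphabet"
proof -
  have "successively (\<lambda>e f. True) c" for c :: "nat list"
    by (induction c rule: induct_list012) simp_all
  then show ?thesis
    unfolding arcs_free_semigroupoid_iff[OF wf_generators] by (simp add: generators_def)
qed

lemma representatives_paths: "representatives \<subseteq> arcs (free_semigroupoid generators)"
  by (auto simp: representatives_def generator_paths_iff codes_def)

text \<open>A prefix of a code is a code ending in its own last label, and it spells a prefix of the
  spelled word.\<close>

lemma representatives_prefix:
  assumes "c \<noteq> []" "c @ d \<in> representatives"
  shows "c \<in> representatives"
proof -
  obtain i l where cd: "i \<in> I" "c @ d \<in> codes i l" "unblock word (c @ d) \<in> K"
    using assms(2) by (auto simp: representatives_def)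
  then have c: "c \<in> codes i (label (last c))"
    using assms(1) by (auto simp: codes_def successively_append_iff)
  then have "last c \<in> alphabet"
    using assms(1) last_in_set by (auto simp: codes_def)
  then have "label (last c) \<in> \<Lambda>"
    using alphabet_in_letters[of "last c"] by (cases "letter (last c)") (auto simp: letters_def)
  moreover have "unblock word c \<noteq> []"
    using codesD[OF c] paths_iff by blast
  then have "unblock word c \<in> K"
    using K_prefix[of "unblock word c" "unblock word d"] cd(3) by simp
  ultimately show ?thesis
    using c cd(1) by (auto simp: representatives_def)
qed

lemma Pref_representatives: "Pref representatives = representatives"
proof (intro equalityI subsetI)
  fix c assume "c \<in> Pref representatives"
  then show "c \<in> representatives"
    using representatives_prefix by (auto simp: Pref_def prefix_def)
next
  fix c assume c: "c \<in> representatives"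
  then have "c \<noteq> []"
    by (auto simp: representatives_def codes_def)
  then show "c \<in> Pref representatives"
    using c by (auto simp: Pref_def)
qed

lemma choice_of_representatives: "choice_of_representatives M generators representatives evaluate"
proof -
  have 1: "semigroupoid_hom (free_semigroupoid generators) M id evaluate"
  proof -
    have "evaluate c \<in> arcs M" if "c \<in> arcs (free_semigroupoid generators)" for c
      using that evaluate_in_arcs by (simp add: generator_paths_iff)
    moreover have "evaluate (mul (free_semigroupoid generators) c d) = mul M (evaluate c) (evaluate d)"
      if "composable (free_semigroupoid generators) c d" for c d
    proof -
      have "mul (free_semigroupoid generators) c d = c @ d"
        by (simp add: free_semigroupoid_def)
      then show ?thesis
        using that evaluate_append by (simp add: composable_def generator_paths_iff)
    qed
    moreover have "verts M = {()}"
      by (simp add: rees_matrix_semigroup_def)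
    ultimately show ?thesis
      unfolding semigroupoid_hom_def by auto
  qed
  have 2: "arcs M \<subseteq> evaluate ` representatives"
  proof
    fix a assume a: "a \<in> arcs M"
    obtain i x l where ixl: "a = (i, x, l)" by (cases a)
    then have x: "i \<in> I" "x \<in> arcs S" "l \<in> \<Lambda>" "F i = tail S x" "head S x = G l"
      using a by (simp_all add: arcs_M_iff)
    then obtain u where u: "u \<in> K" "\<rho> u = x"
      using K_surj by (metis imageE)
    then obtain c where c: "c \<in> codes i l" "unblock word c = u"
      using ex_code[of u i l] x by blast
    then have "evaluate c = a" "c \<in> representatives"
      using codesD[OF c(1)] u x ixl by (auto simp: representatives_def)
    then show "a \<in> evaluate ` representatives" by blast
  qed
  have 3: "evaluate ` arcs (free_semigroupoid generators) \<subseteq> arcs M"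
    using evaluate_in_arcs by (auto simp: generator_paths_iff)
  show ?thesis
    unfolding choice_of_representatives_def
  proof (intro conjI)
    show "verts generators = verts M"
      by (simp add: generators_def rees_matrix_semigroup_def)
  qed (use 1 2 3 wf_generators representatives_paths in blast)+
qed

lemma sync_regular_generators:
  assumes "sync R" "R \<subseteq> representatives \<times> representatives"
  shows "sync_regular generators R"
proof (rule sync_imp_sync_regular[OF wf_generators _ _ assms(1)])
  show "R \<subseteq> arcs (free_semigroupoid generators) \<times> arcs (free_semigroupoid generators)"
    using assms(2) representatives_paths by blast
qed (simp_all add: generators_def finite_alphabet)

lemma sync_codes:
  assumes "sync R" "R \<subseteq> K \<times> K"
  shows "sync {(c, d). c \<in> codes i l \<and> d \<in> codes i l' \<and> (unblock word c, unblock word d) \<in> R}"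
proof (rule sync_unblock[OF assms(1) _ finite_X reg_codes codes_subset_blocked reg_codes codes_subset_blocked])
  have "paths \<subseteq> lists (arcs X)"
    by (auto simp: paths_iff)
  then show "R \<subseteq> lists (arcs X) \<times> lists (arcs X)"
    using assms(2) K_paths by blast
qed

text \<open>By \<open>codesD\<close> two codes have the same value exactly when both indices and the
  values of the spelled words agree; there are finitely many pairs of indices.\<close>

lemma sync_eq: "sync {(c, d) \<in> representatives \<times> representatives. evaluate c = evaluate d}"
proof -
  have "{(c, d) \<in> representatives \<times> representatives. evaluate c = evaluate d} =
    (\<Union>i \<in> I. \<Union>l \<in> \<Lambda>. {(c, d). c \<in> codes i l \<and> d \<in> codes i l \<and> (unblock word c, unblock word d) \<in> eq_rel K})"
    (is "?A = ?B")
  proof (intro equalityI subrelI)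
    fix c d assume "(c, d) \<in> ?A"
    then obtain i l i' l' where c: "i \<in> I" "l \<in> \<Lambda>" "c \<in> codes i l" "unblock word c \<in> K"
      and d: "d \<in> codes i' l'" "unblock word d \<in> K" and e: "evaluate c = evaluate d"
      by (auto simp: representatives_def)
    then have "i' = i" "l' = l" "\<rho> (unblock word c) = \<rho> (unblock word d)"
      using codesD[OF c(3)] codesD[OF d(1)] by simp_all
    then show "(c, d) \<in> ?B"
      using c d by (auto simp: eq_rel_def)
  next
    fix c d assume "(c, d) \<in> ?B"
    then obtain i l where cd: "i \<in> I" "l \<in> \<Lambda>" "c \<in> codes i l" "d \<in> codes i l"
      "(unblock word c, unblock word d) \<in> eq_rel K"
      by blast
    then have "evaluate c = evaluate d"
      using codesD[OF cd(3)] codesD[OF cd(4)] by (simp add: eq_rel_def)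
    then show "(c, d) \<in> ?A"
      using cd by (auto simp: representatives_def eq_rel_def)
  qed
  moreover have "sync ?B"
    by (intro sync_UN finite_I finite_\<Lambda> sync_codes K_eq) (auto simp: eq_rel_def)
  ultimately show ?thesis by simp
qed

text \<open>On codes with last label \<open>l\<close>, the generator \<open>(j, y, k)\<close>
  multiplies the middle entry by \<open>mul S (P l j) y\<close>. The multiplier varies only with
  \<open>l\<close>, so finitely many multiplier relations of \<open>S\<close> suffice.\<close>

lemma sync_edge:
  assumes "a \<in> alphabet"
  shows "sync {(c, d) \<in> representatives \<times> representatives. evaluate (c @ [a]) = evaluate d}"
proof -
  obtain j y k where jyk: "letter_value (letter a) = (j, y, k)"
    by (cases "letter_value (letter a)")
  then have arc: "(j, y, k) \<in> arcs M"
    using letter_value_in_arcs[OF alphabet_in_letters[OF assms]] by simp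
  let ?s = "\<lambda>l. mul S (P l j) y"
  have comp: "composable S (P l j) y" if "l \<in> \<Lambda>" for l
    using arc that by (simp add: arcs_M_iff composable_def P_arrow head_P)
  have ev: "evaluate (c @ [a]) = (i, mul S (\<rho> (unblock word c)) (?s l), k) \<and>
      head S (\<rho> (unblock word c)) = tail S (?s l)"
    if c: "c \<in> codes i l" and l: "l \<in> \<Lambda>" for c i l
  proof -
    have ne: "c \<noteq> []"
      using c by (simp add: codes_def)
    let ?u = "unblock word c"
    have "composable S (\<rho> ?u) (P l j)"
      using codesD[OF c] rho_in_arcs arc l by (simp add: composable_def arcs_M_iff P_arrow tail_P)
    then have "mul S (\<rho> ?u) (?s l) = mul S (mul S (\<rho> ?u) (P l j)) y"
      using mul_assoc comp[OF l] by blast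
    then show ?thesis
      using evaluate_snoc[OF ne, of a] codesD[OF c] jyk tail_mul[OF comp[OF l]] arc l
      by (simp add: mul_M arcs_M_iff tail_P)
  qed
  have "{(c, d) \<in> representatives \<times> representatives. evaluate (c @ [a]) = evaluate d} =
    (\<Union>i \<in> I. \<Union>l \<in> \<Lambda>. {(c, d). c \<in> codes i l \<and> d \<in> codes i k \<and>
      (unblock word c, unblock word d) \<in> mult_rel K (?s l)})" (is "?A = ?B")
  proof (intro equalityI subrelI)
    fix c d assume "(c, d) \<in> ?A"
    then obtain i l i' l' where c: "i \<in> I" "l \<in> \<Lambda>" "c \<in> codes i l" "unblock word c \<in> K"
      and d: "d \<in> codes i' l'" "unblock word d \<in> K" and e: "evaluate (c @ [a]) = evaluate d"
      by (auto simp: representatives_def)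
    then have "i' = i" "l' = k" "mul S (\<rho> (unblock word c)) (?s l) = \<rho> (unblock word d)"
      using ev[OF c(3,2)] codesD[OF d(1)] by simp_all
    then show "(c, d) \<in> ?B"
      using c d ev[OF c(3,2)] by (auto simp: mult_rel_def)
  next
    fix c d assume "(c, d) \<in> ?B"
    then obtain i l where cd: "i \<in> I" "l \<in> \<Lambda>" "c \<in> codes i l" "d \<in> codes i k"
      "(unblock word c, unblock word d) \<in> mult_rel K (?s l)"
      by blast
    then have "evaluate (c @ [a]) = evaluate d"
      using ev[OF cd(3,2)] codesD[OF cd(4)] by (simp add: mult_rel_def)
    moreover have "k \<in> \<Lambda>"
      using arc by (simp add: arcs_M_iff)
    ultimately show "(c, d) \<in> ?A"
      using cd by (auto simp: representatives_def mult_rel_def)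
  qed
  moreover have "sync ?B"
    by (intro sync_UN finite_I finite_\<Lambda> sync_codes K_mult mul_closed comp) (auto simp: mult_rel_def)
  ultimately show ?thesis by simp
qed

theorem prefix_automatic_M: "prefix_automatic M"
proof -
  have eq: "sync_regular generators {(c, d) \<in> representatives \<times> representatives. evaluate c = evaluate d}"
    by (rule sync_regular_generators[OF sync_eq]) auto
  have edge: "sync_regular generators
      {(c, d) \<in> representatives \<times> representatives. evaluate (c @ [a]) = evaluate d}"
    if "a \<in> alphabet" for a
    by (rule sync_regular_generators[OF sync_edge[OF that]]) auto
  have "automatic_structure M generators representatives evaluate"
    \<comment> \<open>With a single vertex, the vertex relation is the whole equality
      relation.\<close>
    using choice_of_representatives eq edge finite_alphabet
    by (simp add: automatic_structure_def fg_choice_of_representatives_def edge_relation_def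
        vertex_relation_def generators_def)
  then have "prefix_automatic_structure M generators representatives evaluate"
    using eq by (simp add: prefix_automatic_structure_def Pref_representatives)
  then show ?thesis
    unfolding prefix_automatic_def by blast
qed

end

theorem theorem6p3:
  fixes S :: "('v, 'a) pre_semigroupoid"
    and I :: "'i set" and \<Lambda> :: "'l set"
    and F :: "'i \<Rightarrow> 'v" and G :: "'l \<Rightarrow> 'v" and P :: "'l \<Rightarrow> 'i \<Rightarrow> 'a"
  assumes "rees_matrix_data S I \<Lambda> F G P"
    and "finitely_generated (rees_matrix_semigroup S I \<Lambda> F G P)"
    and "prefix_automatic S"
    and "weakly_right_ideal_generated_by_row_cross_section S I \<Lambda> G P
           {s \<in> arcs S. \<not> is_identity S s}"
  shows "prefix_automatic (rees_matrix_semigroup S I \<Lambda> F G P)"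
proof -
  interpret rees_matrix_data S I \<Lambda> F G P
    by (rule assms(1))
  obtain \<Lambda>' where cross: "\<Lambda>' \<subseteq> \<Lambda>" "bij_betw G \<Lambda>' (head S ` arcs S)"
    and gen: "\<forall>t \<in> {s \<in> arcs S. \<not> is_identity S s}.
      \<exists>l \<in> \<Lambda>'. \<exists>i \<in> I. t = P l i \<or> (\<exists>s. composable S (P l i) s \<and> t = mul S (P l i) s)"
    using assms(4) unfolding weakly_right_ideal_generated_by_row_cross_section_def
    by (elim exE conjE)
  obtain X :: "('v, nat) pre_digraph" and K0 \<rho> where "prefix_automatic_structure S X K0 \<rho>"
    using assms(3) unfolding prefix_automatic_def by (elim exE)
  then show ?thesis
  proof (rule prefix_automatic_structure_imp_normal_form[OF semigroupoid_axioms])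
    fix K N
    assume rep: "represented_semigroupoid S X \<rho>" and fin: "finite (arcs X)"
      and K: "K \<subseteq> arcs (free_semigroupoid X)" "\<rho> ` K = arcs S"
        "sync (represented_semigroupoid.eq_rel \<rho> K)"
        "\<And>s. s \<in> arcs S \<Longrightarrow> sync (represented_semigroupoid.mult_rel S \<rho> K s)"
        "\<And>p w. p \<noteq> [] \<Longrightarrow> p @ w \<in> K \<Longrightarrow> p \<in> K"
      and ident: "\<And>p w. p \<noteq> [] \<Longrightarrow> w \<noteq> [] \<Longrightarrow> N \<le> length w \<Longrightarrow> p @ w \<in> K \<Longrightarrow> \<not> is_identity S (\<rho> w)"
    interpret represented_semigroupoid S X \<rho> by (rule rep)
    have block: "\<exists>l \<in> \<Lambda>'. \<exists>i \<in> I. \<exists>s. composable S (P l i) s \<and> \<rho> w = mul S (P l i) s"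
      if p: "p \<noteq> []" and w: "length w = N + 2" and pw: "p @ w \<in> K" for p w
    proof -
      \<comment> \<open>The length \<open>N + 2\<close> leaves \<open>N + 1\<close> letters for
        \<open>v\<close>: it is non-empty and too long to be an identity. The spare edge
        \<open>b\<close> supplies a right factor even when \<open>\<rho> v\<close> is a bare entry
        \<open>P l i\<close>.\<close>
      obtain v b where v: "w = v @ [b]" "length v = Suc N"
        using w by (cases w rule: rev_cases) auto
      then have v: "w = v @ [b]" "v \<noteq> []" "N \<le> length v"
        by auto
      have "p @ v \<in> K"
        using K(5)[of "p @ v" "[b]"] pw p v(1) by simp
      then have "\<not> is_identity S (\<rho> v)"
        using ident p v by blast
      moreover have wp: "v @ [b] \<in> paths"
        using append_in_pathsD(2)[of p w] pw K(1) p v by auto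
      have vb: "v \<in> paths" "[b] \<in> paths" "head S (\<rho> v) = tail S (\<rho> [b])"
        using append_in_pathsD[OF wp v(2)] by simp_all
      ultimately obtain l i where li: "l \<in> \<Lambda>'" "i \<in> I"
        and "\<rho> v = P l i \<or> (\<exists>s. composable S (P l i) s \<and> \<rho> v = mul S (P l i) s)"
        using gen rho_in_arcs by blast
      then consider "\<rho> v = P l i" | s where "composable S (P l i) s" "\<rho> v = mul S (P l i) s"
        by blast
      then have "\<exists>s. composable S (P l i) s \<and> \<rho> w = mul S (P l i) s"
      proof cases
        case 1
        then show ?thesis
          using vb rho_append[OF vb] rho_in_arcs v(1) by (metis composable_def)
      next
        case 2
        have c: "composable S s (\<rho> [b])"
          using 2 vb rho_in_arcs head_mul[OF 2(1)] by (simp add: composable_def)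
        then have "composable S (P l i) (mul S s (\<rho> [b]))"
          using 2(1) mul_closed[OF c] tail_mul[OF c] by (simp add: composable_def)
        moreover have "\<rho> w = mul S (P l i) (mul S s (\<rho> [b]))"
          using rho_append[OF vb] v(1) 2(2) mul_assoc[OF 2(1) c] by simp
        ultimately show ?thesis by blast
      qed
      then show ?thesis
        using li by blast
    qed
    interpret rees_block_coding S I \<Lambda> F G P X \<rho> K "N + 2" \<Lambda>'
      using finite_index_sets[OF assms(2)] fin K cross block by unfold_locales simp_all
    show ?thesis
      by (rule prefix_automatic_M)
  qed
qed

end
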